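(* Let $N$ be even, $3\le n\le m$, $1\le k<N/2$, and let $\alpha=n$. Let $\mathcal{T}=\bigcup_{\ell,p=0}^{k}\{\sigma_{\mathscr{A}_{\ell,p}}\}$. Then: (i) if $m=n$, any $\omega\in(\mathbf{-1}\to\mathbf{+1})_{opt}$ must pass through $\Sigma_{\mathscr{R}^A_{n,a,1}}$ and $\Sigma_{V\setminus\mathscr{R}^B_{n,a,1}}$ for any $a=n-1,\dots,N-2$; (ii) if $m>n$, any $\omega\in(\mathbf{-1}\to\mathcal{T})_{opt}$ must pass through $\Sigma_{\mathscr{R}^A_{n,a,1}}$ for any $a=n-1,\dots,N-2$. (Passing through a set of configurations means visiting at least one of its elements.)
   Context: Let $V=\{(i,j)\in\mathbb{Z}^2: 1\le i,j\le N\}$ be the vertex set of the $N\times N$ grid graph with periodic boundary conditions (toric grid), with edge set $E$. The columns of the torus are partitioned, in cyclic order, into four vertical strips (unions of consecutive full columns) $A,S_1,B,S_2$ of widths $n,k,m,k$, so $N=n+m+2k$. Configurations are $\sigma\in\mathcal{X}=\{-1,+1\}^V$, with Hamiltonian $$H(\sigma)=-\sum_{i\in A}\sigma_i+\sum_{i\in B}\sigma_i-\frac{\alpha}{2}\sum_{(i,j)\in E}\sigma_i\sigma_j .$$ $\mathbf{+1},\mathbf{-1}$ are the constant configurations. For $\bar V\subset V$, $\sigma_{\bar V}$ equals $+1$ on $\bar V$ and $-1$ off $\bar V$. For $0\le\ell,p\le k$, $\mathscr{A}_{\ell,p}$ is the union of $A$, the $\ell$ columns of $S_1$ closest to $A$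 and the $p$ columns of $S_2$ closest to $A$. A path is a finite sequence of configurations, consecutive ones differing at exactly one site. For a configuration $\eta$ and a configuration or set of configurations $W$, $\Phi(\eta,W)$ is the minimum over all paths $\omega$ from $\eta$ to (an element of) $W$ of $\max_{\zeta\in\omega}H(\zeta)$, and $(\eta\to W)_{opt}$ is the set of paths from $\eta$ to (an element of) $W$ attaining this minimum. Identify a set of sites with the union of the closed unit squares centered at its sites. For $1\le a,b\le N-2$, $0\le q\le\min\{a,b\}-1$ and $S\subset V$, $\mathscr{R}^S_{a,b,q}$ denotes a subset of sites of $S$ whose associated union of squares is an $a\times b$ rectangle with a protuberance of length $q$ (an edge-connected bar of $q$ unit squares) attached to the shortest side. $\Sigma_{\mathscr{R}^A_{n,a,1}}$ is the set of configurations with positive opinion exactly on a set $\mathscr{R}^A_{n,a,1}\subset A$ and negative opinion elsewhere; $\Sigma_{V\setminus\mathscr{R}^B_{n,a,1}}$ is the set of configurations with negative opinion exactly on a set $\mathscr{R}^B_{n,a,1}\subset B$ and positive opinion elsewhere.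
   Formalization: For a=n-1 the unit protuberance is taken on a side of length n of the n×(n-1) rectangle, not on its shortest side: with the shortest side the claim fails, since the optimal path filling A row by row never visits such a set. *)

theory Defs
  imports Complex_Main "HOL-Library.FuncSet"
begin

(* Sites are pairs (i, j): i is the index of the column, j the height in that column. *)

type_synonym site = "int \<times> int"
type_synonym conf = "site \<Rightarrow> real"

definition torus :: "nat \<Rightarrow> site set" where
  "torus N = {1..int N} \<times> {1..int N}"

(* Each edge is counted once, as an unordered pair of sites (this is the intended toric grid for
   N \<ge> 3, the only case used). *)
definition torus_edges :: "nat \<Rightarrow> site set set" where
  "torus_edges N = {{x, y} | x y. x \<in> torus N \<and> y \<in> torus N \<and>
     (fst x = fst y \<and> (snd y - snd x) mod int N = 1 \<or>
      snd x = snd y \<and> (fst y - fst x) mod int N = 1)}"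

(* The w cyclically consecutive indices s, s + 1, ..., s + w - 1, reduced modulo N to 1, ..., N
   (for w \<le> N); empty for w = 0. *)
definition arc :: "nat \<Rightarrow> int \<Rightarrow> nat \<Rightarrow> int set" where
  "arc N s w = {i \<in> {1..int N}. (i - s) mod int N < int w}"

definition strip :: "nat \<Rightarrow> int \<Rightarrow> nat \<Rightarrow> site set" where
  "strip N s w = arc N s w \<times> {1..int N}"

(* The strips in cyclic order; s is the first column of A, and N = n + m + 2 k is the torus size. *)

definition strip_A :: "int \<Rightarrow> nat \<Rightarrow> nat \<Rightarrow> nat \<Rightarrow> site set" where
  "strip_A s n m k = strip (n + m + 2 * k) s n"

definition strip_S1 :: "int \<Rightarrow> nat \<Rightarrow> nat \<Rightarrow> nat \<Rightarrow> site set" where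
  "strip_S1 s n m k = strip (n + m + 2 * k) (s + int n) k"

definition strip_B :: "int \<Rightarrow> nat \<Rightarrow> nat \<Rightarrow> nat \<Rightarrow> site set" where
  "strip_B s n m k = strip (n + m + 2 * k) (s + int n + int k) m"

definition strip_S2 :: "int \<Rightarrow> nat \<Rightarrow> nat \<Rightarrow> nat \<Rightarrow> site set" where
  "strip_S2 s n m k = strip (n + m + 2 * k) (s + int n + int k + int m) k"

(* S1 begins with the column right after A, and S2 ends with the column right before A. *)
definition widened_A :: "int \<Rightarrow> nat \<Rightarrow> nat \<Rightarrow> nat \<Rightarrow> nat \<Rightarrow> nat \<Rightarrow> site set" where
  "widened_A s n m k l p = strip_A s n m k
     \<union> strip (n + m + 2 * k) (s + int n) l
     \<union> strip (n + m + 2 * k) (s - int p) p"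

definition configs :: "nat \<Rightarrow> conf set" where
  "configs N = torus N \<rightarrow>\<^sub>E {-1, 1}"

definition conf_of :: "nat \<Rightarrow> site set \<Rightarrow> conf" where
  "conf_of N W = (\<lambda>x\<in>torus N. if x \<in> W then 1 else -1)"

definition all_plus :: "nat \<Rightarrow> conf" where
  "all_plus N = (\<lambda>x\<in>torus N. 1)"

definition all_minus :: "nat \<Rightarrow> conf" where
  "all_minus N = (\<lambda>x\<in>torus N. -1)"

definition hamiltonian :: "nat \<Rightarrow> site set \<Rightarrow> site set \<Rightarrow> real \<Rightarrow> conf \<Rightarrow> real" where
  "hamiltonian N A B \<alpha> \<sigma> =
     - (\<Sum>x\<in>A. \<sigma> x) + (\<Sum>x\<in>B. \<sigma> x) - \<alpha> / 2 * (\<Sum>e\<in>torus_edges N. \<Prod>x\<in>e. \<sigma> x)"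

definition is_path :: "nat \<Rightarrow> conf list \<Rightarrow> bool" where
  "is_path N \<omega> \<longleftrightarrow> \<omega> \<noteq> [] \<and> set \<omega> \<subseteq> configs N \<and>
     successively (\<lambda>\<sigma> \<tau>. card {x \<in> torus N. \<sigma> x \<noteq> \<tau> x} = 1) \<omega>"

definition paths :: "nat \<Rightarrow> conf \<Rightarrow> conf set \<Rightarrow> conf list set" where
  "paths N \<eta> W = {\<omega>. is_path N \<omega> \<and> hd \<omega> = \<eta> \<and> last \<omega> \<in> W}"

definition path_height :: "(conf \<Rightarrow> real) \<Rightarrow> conf list \<Rightarrow> real" where
  "path_height H \<omega> = Max (H ` set \<omega>)"

(* There are infinitely many paths but, configs N being finite, only finitely many heights. *)
definition comm_height :: "nat \<Rightarrow> (conf \<Rightarrow> real) \<Rightarrow> conf \<Rightarrow> conf set \<Rightarrow> real" where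
  "comm_height N H \<eta> W = Min (path_height H ` paths N \<eta> W)"

definition opt_paths :: "nat \<Rightarrow> (conf \<Rightarrow> real) \<Rightarrow> conf \<Rightarrow> conf set \<Rightarrow> conf list set" where
  "opt_paths N H \<eta> W = {\<omega> \<in> paths N \<eta> W. path_height H \<omega> = comm_height N H \<eta> W}"

definition strip_confs :: "int \<Rightarrow> nat \<Rightarrow> nat \<Rightarrow> nat \<Rightarrow> conf set" where
  "strip_confs s n m k = {conf_of (n + m + 2 * k) (widened_A s n m k l p) | l p. l \<le> k \<and> p \<le> k}"

(* Rectangles of width a and height b whose bar, of q squares, lies along the upper or the lower
   side (of length a). Rectangles may wrap around the torus. *)
definition bar_rects :: "nat \<Rightarrow> nat \<Rightarrow> nat \<Rightarrow> nat \<Rightarrow> site set set" where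
  "bar_rects N a b q = {arc N x a \<times> arc N y b \<union> arc N t q \<times> arc N z 1 | x y t z.
     arc N t q \<subseteq> arc N x a \<and> (z = y + int b \<or> z = y - 1)}"

(* The subsets of S that are a rectangle with side lengths a and b, in either orientation, plus a
   bar of length q attached to a side of length a. For a \<le> b this is the shortest side, the
   usual description of these sets. The only other case needed is the quasi-square b = a - 1 (the
   critical droplet), where the bar starts the growth from a \<times> (a - 1) to a \<times> a and so
   again lies along a side of length a, not along the side of length a - 1. *)
definition protub_rects :: "nat \<Rightarrow> site set \<Rightarrow> nat \<Rightarrow> nat \<Rightarrow> nat \<Rightarrow> site set set" where
  "protub_rects N S a b q =
     {R. R \<subseteq> S \<and> (R \<in> bar_rects N a b q \<or> prod.swap ` R \<in> bar_rects N a b q)}"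

definition Sigma_plus :: "nat \<Rightarrow> site set set \<Rightarrow> conf set" where
  "Sigma_plus N \<R> = conf_of N ` \<R>"

definition Sigma_minus :: "nat \<Rightarrow> site set set \<Rightarrow> conf set" where
  "Sigma_minus N \<R> = (\<lambda>R. conf_of N (torus N - R)) ` \<R>"

end

(* The energy of a set X of plus sites, relative to the all-minus configuration, is
   n * perimeter - 2 |X Int A| + 2 |X Int B|, and the relevant barrier is 2 n^2 + 2 n - 2.
   Filling A row by row never exceeds it, and neither does widening the full strip column by column;
   for m = n the last part of the route to the all-plus configuration is the complement of the
   reversed route for B. So every optimal path stays at or below the barrier.
   Conversely, let r and c be the numbers of occupied rows and columns. Every nonempty non-full row
   or column carries at least two boundary edges. Consider the first time that r >= a + 1
   together with (c >= n or r = N). If a row is being opened, every other row contributes at least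
   2 n - 2 n = 0 and the columns at least 2 n^2, so the energy is at least the barrier, with equality only for the n x a rectangle in A
   plus one site. If a column is being opened, the energy is at least 2 n^2 + 2 r - 2, which forces
   r = n, a = n - 1 and the same shape lying on its side. Reaching r = N with c < n is impossible,
   since a configuration with r = N - 1 and c < n lies strictly above the barrier. *)

theory Submission
  imports Defs
begin

section \<open>Cyclic intervals and their boundary\<close>

text \<open>The constant reflects a degeneracy of \<alpha> = n. An n x a rectangle in A with a < N
  has energy 2n(n + a) - 2na = 2n^2 for every a: a new row adds two boundary edges, costing 2n, and
  gains exactly 2n from the field. Beginning it costs 2n - 2 each time, so a single threshold
  detects the rectangles of all heights. Projections onto rows and columns serve as order parameters
  because adding a site never decreases them and changes each by at most one. At a crossing the
  energy is a sum of separately bounded terms whose minima add up to the barrier, so being at or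
  below the barrier puts every term at its minimum. These equalities fix the shape: the projections
  are known, and two boundary edges on a line mean that its occupied part is one arc. The obstacle
  is winding around the torus, since a full line has no boundary. A full row is harmless: it also
  crosses B, and m >= n makes its field contribution nonnegative. A full column is not, which is why
  tall narrow sets have to be excluded one row before they can close up.\<close>

definition cnext :: "nat \<Rightarrow> int \<Rightarrow> int" where
  "cnext N i = (if i = int N then 1 else i + 1)"

definition cprev :: "nat \<Rightarrow> int \<Rightarrow> int" where
  "cprev N i = (if i = 1 then int N else i - 1)"

text \<open>Parametrises the cycle from the starting index \<open>s\<close>, with period
  \<open>N\<close> in \<open>d\<close>. The shift by 1 before and after the reduction selects
  representatives in 1..N.\<close>

definition offset :: "nat \<Rightarrow> int \<Rightarrow> nat \<Rightarrow> int" where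
  "offset N s d = (s + int d - 1) mod int N + 1"

text \<open>The edge of the cycle between \<open>i\<close> and its successor is labelled by
  \<open>i\<close>, so the cardinality of this set counts the edges with exactly one end in
  \<open>S\<close>.\<close>

definition cyc_boundary :: "nat \<Rightarrow> int set \<Rightarrow> int set" where
  "cyc_boundary N S = {i \<in> {1..int N}. (i \<in> S) \<noteq> (cnext N i \<in> S)}"

lemma cnext_in: "i \<in> {1..int N} \<Longrightarrow> cnext N i \<in> {1..int N}"
  by (auto simp: cnext_def)

lemma cnext_cprev: "i \<in> {1..int N} \<Longrightarrow> cnext N (cprev N i) = i"
  by (auto simp: cnext_def cprev_def)

lemma cprev_cnext: "i \<in> {1..int N} \<Longrightarrow> cprev N (cnext N i) = i"
  by (auto simp: cnext_def cprev_def)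

lemma cnext_eq_iff_mod:
  assumes "i \<in> {1..int N}" "j \<in> {1..int N}" "2 \<le> N"
  shows "(j - i) mod int N = 1 \<longleftrightarrow> j = cnext N i"
proof (cases "i \<le> j")
  case True
  then have "(j - i) mod int N = j - i" using assms by (intro mod_pos_pos_trivial) auto
  then show ?thesis using assms True by (auto simp: cnext_def)
next
  case False
  have "(j - i) mod int N = (j - i + int N) mod int N" by simp
  also have "\<dots> = j - i + int N" using assms False by (intro mod_pos_pos_trivial) auto
  finally show ?thesis using assms False by (auto simp: cnext_def)
qed

lemma offset_in:
  assumes "0 < N" shows "offset N s d \<in> {1..int N}"
proof -
  have "0 \<le> (s + int d - 1) mod int N" "(s + int d - 1) mod int N < int N" using assms by auto
  then show ?thesis unfolding offset_def atLeastAtMost_iff by linarith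
qed

lemma cnext_offset:
  assumes "0 < N" shows "cnext N (offset N s d) = offset N s (Suc d)"
proof -
  let ?u = "(s + int d - 1) mod int N"
  have u: "0 \<le> ?u" "?u < int N" using assms by auto
  have "(s + int (Suc d) - 1) mod int N = (?u + 1) mod int N"
    by (simp add: mod_add_left_eq algebra_simps) (metis add.commute diff_add_cancel mod_add_left_eq)
  also have "\<dots> = (if ?u + 1 = int N then 0 else ?u + 1)"
    using u by (auto intro: mod_pos_pos_trivial)
  finally show ?thesis by (auto simp: cnext_def offset_def)
qed

lemma offset_0: "y \<in> {1..int N} \<Longrightarrow> offset N y 0 = y"
  by (auto simp: offset_def mod_pos_pos_trivial)

lemma offset_eq_iff:
  "offset N s d = offset N s e \<longleftrightarrow> d mod N = e mod N"
proof -
  have "offset N s d = offset N s e \<longleftrightarrow> (s - 1 + int d) mod int N = (s - 1 + int e) mod int N"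
    by (simp add: offset_def algebra_simps)
  also have "\<dots> \<longleftrightarrow> int d mod int N = int e mod int N"
    by (metis add_diff_cancel_left' mod_add_right_eq mod_diff_left_eq)
  finally show ?thesis by (metis zmod_int nat_int)
qed

lemma offset_inj: "inj_on (offset N s) {..<N}"
  by (auto simp: inj_on_def offset_eq_iff)

lemma offset_surj:
  assumes "i \<in> {1..int N}"
  obtains d where "d < N" "i = offset N s d" "(i - s) mod int N = int d"
proof
  let ?d = "nat ((i - s) mod int N)"
  have N: "0 < int N" using assms by auto
  then have d: "int ?d = (i - s) mod int N" by (intro nat_0_le pos_mod_sign)
  show "?d < N" using N d by (metis of_nat_less_iff pos_mod_bound)
  have "(s + int ?d - 1) mod int N = (s - 1 + (i - s) mod int N) mod int N"
    unfolding d by (simp add: algebra_simps)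
  also have "\<dots> = (i - 1) mod int N" by (simp add: mod_add_right_eq)
  also have "\<dots> = i - 1" using assms by (intro mod_pos_pos_trivial) auto
  finally show "i = offset N s ?d" by (simp add: offset_def)
  show "(i - s) mod int N = int ?d" by (rule d[symmetric])
qed

text \<open>Trades the residue condition of \<open>arc\<close> for the image of an initial segment.
  Since \<open>w \<le> N\<close> the parameters do not repeat, and questions of size and adjacency
  become questions about natural numbers.\<close>

lemma arc_eq_offset:
  assumes "w \<le> N" shows "arc N s w = offset N s ` {..<w}"
proof (intro equalityI subsetI)
  fix i assume "i \<in> arc N s w"
  then have i: "i \<in> {1..int N}" "(i - s) mod int N < int w" by (auto simp: arc_def)
  then show "i \<in> offset N s ` {..<w}" by (metis offset_surj of_nat_less_iff imageI lessThan_iff)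
next
  fix i assume "i \<in> offset N s ` {..<w}"
  then obtain d where d: "d < w" "i = offset N s d" by auto
  with assms have i: "i \<in> {1..int N}" by (auto simp only: intro!: offset_in)
  obtain e where e: "e < N" "i = offset N s e" "(i - s) mod int N = int e"
    using offset_surj[OF i] by metis
  have "e = d" using d e assms offset_eq_iff[of N s d e] by auto
  then show "i \<in> arc N s w" using i d e by (simp add: arc_def)
qed

lemma card_arc: "w \<le> N \<Longrightarrow> card (arc N s w) = w"
  by (simp add: arc_eq_offset card_image inj_on_subset[OF offset_inj])

lemma arc_subset: "arc N s w \<subseteq> {1..int N}"
  by (auto simp: arc_def)

lemma arc_one: "i \<in> {1..int N} \<Longrightarrow> arc N i 1 = {i}"
  by (subst arc_eq_offset) (auto simp: offset_0)

lemma finite_cyc_boundary [simp]: "finite (cyc_boundary N S)"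
  by (rule finite_subset[of _ "{1..int N}"]) (auto simp: cyc_boundary_def)

text \<open>Otherwise \<open>S\<close> would be closed under the successor map, whose orbit through
  \<open>p\<close> is the whole cycle and contains \<open>q\<close>.\<close>

lemma cyc_boundary_exit:
  assumes "p \<in> S" "q \<notin> S" "p \<in> {1..int N}" "q \<in> {1..int N}"
  shows "\<exists>i\<in>{1..int N}. i \<in> S \<and> cnext N i \<notin> S"
proof (rule ccontr)
  assume "\<not> ?thesis"
  then have closed: "cnext N i \<in> S" if "i \<in> S" "i \<in> {1..int N}" for i using that by blast
  have N: "0 < N" using assms by auto
  have "offset N p d \<in> S" for d
  proof (induction d)
    case 0
    then show ?case using assms by (simp add: offset_0)
  next
    case (Suc d)
    then show ?case using closed[OF Suc offset_in[OF N]] cnext_offset[OF N] by simp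
  qed
  then show False using offset_surj[OF assms(4), of p] assms(2) by metis
qed

lemma cyc_boundary_compl: "cyc_boundary N ({1..int N} - S) = cyc_boundary N S"
  using cnext_in by (auto simp: cyc_boundary_def)

text \<open>Going around the cycle one leaves \<open>S\<close> and also leaves its complement. The
  labels of these two edges lie one inside and one outside \<open>S\<close>, so the edges are
  distinct.\<close>

lemma cyc_boundary_ge_2:
  assumes "S \<subseteq> {1..int N}" "S \<noteq> {}" "S \<noteq> {1..int N}"
  shows "2 \<le> card (cyc_boundary N S)"
proof -
  obtain p q where pq: "p \<in> S" "q \<notin> S" "p \<in> {1..int N}" "q \<in> {1..int N}"
    using assms by blast
  obtain i where i: "i \<in> {1..int N}" "i \<in> S" "cnext N i \<notin> S"
    using cyc_boundary_exit[OF pq] by blast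
  obtain j where j: "j \<in> {1..int N}" "j \<notin> S" "cnext N j \<in> S"
    using cyc_boundary_exit[of q "- S" p N] pq by auto
  have "{i, j} \<subseteq> cyc_boundary N S" using i j by (auto simp: cyc_boundary_def)
  then have "card {i, j} \<le> card (cyc_boundary N S)" by (intro card_mono) auto
  then show ?thesis using i j by (cases "i = j") auto
qed

text \<open>Read the cycle from the point \<open>y\<close> just behind an entry edge. Once
  \<open>S\<close> has been left, a return to it would create a third boundary edge, besides that
  exit and the entry edge chosen as the start.\<close>

lemma cyc_boundary_2_arc:
  assumes S: "S \<subseteq> {1..int N}" and two: "card (cyc_boundary N S) = 2"
  obtains y where "y \<in> {1..int N}" "S = arc N y (card S)"
proof -
  have "cyc_boundary N {} = {}" "cyc_boundary N {1..int N} = {}"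
    using cnext_in by (auto simp: cyc_boundary_def)
  then have "S \<noteq> {}" "S \<noteq> {1..int N}" using two by auto
  then obtain p q where pq: "p \<in> S" "q \<notin> S" "p \<in> {1..int N}" "q \<in> {1..int N}"
    using S by blast
  have N: "0 < N" using pq by auto
  obtain j where j: "j \<in> {1..int N}" "j \<notin> S" "cnext N j \<in> S"
    using cyc_boundary_exit[of q "- S" p N] pq by auto
  define y where "y = cnext N j"
  have y: "y \<in> {1..int N}" "y \<in> S" using j cnext_in by (auto simp: y_def)
  let ?f = "offset N y"
  have f0: "?f 0 \<in> S" using y by (simp add: offset_0)
  have last: "?f (N - 1) = j"
  proof -
    have "cnext N (?f (N - 1)) = ?f 0" using cnext_offset[OF N] N offset_eq_iff[of N y N 0] by simp
    then have "cnext N (?f (N - 1)) = cnext N j" using y by (simp add: offset_0 y_def)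
    then show ?thesis using cprev_cnext[OF offset_in[OF N]] cprev_cnext[OF j(1)] by metis
  qed
  \<comment> \<open>The first exit from \<open>S\<close>; it exists because the tour starting at
    \<open>y\<close> ends at \<open>j\<close>, which is outside \<open>S\<close>.\<close>
  define w where "w = (LEAST d. ?f d \<notin> S)"
  have "\<exists>d. ?f d \<notin> S" using last j by auto
  then have "?f w \<notin> S" unfolding w_def by (rule LeastI_ex)
  moreover have "\<And>d. d < w \<Longrightarrow> ?f d \<in> S" unfolding w_def by (auto dest: not_less_Least)
  ultimately have w: "?f w \<notin> S" "\<And>d. d < w \<Longrightarrow> ?f d \<in> S" by blast+
  have wN: "w \<le> N - 1" using last j w(2) by (metis not_le)
  have w0: "0 < w" using f0 w(1) by (metis gr0I)
  have after: "?f d \<notin> S" if "w \<le> d" "d < N" for d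
  proof
    assume d: "?f d \<in> S"
    have "\<exists>e\<le>d. (\<forall>c<e. \<not> (w \<le> c \<and> ?f c \<in> S)) \<and> w \<le> e \<and> ?f e \<in> S"
      using ex_least_nat_le[of "\<lambda>d. w \<le> d \<and> ?f d \<in> S" d] d that by simp
    then obtain e where e: "w \<le> e" "?f e \<in> S" "e \<le> d" "\<And>c. c < e \<Longrightarrow> w \<le> c \<Longrightarrow> ?f c \<notin> S"
      by blast
    have we: "w < e" using e w by (metis le_neq_implies_less)
    have b: "?f c \<in> cyc_boundary N S" if "(?f c \<in> S) \<noteq> (?f (Suc c) \<in> S)" for c
      using that offset_in[OF N] cnext_offset[OF N] by (auto simp: cyc_boundary_def)
    \<comment> \<open>Three boundary edges: the first exit, the assumed re-entry, and the entry edge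
      at parameter N - 1 that closes the tour.\<close>
    have "?f (w - 1) \<in> cyc_boundary N S" using b[of "w - 1"] w w0 by simp
    moreover have "?f (e - 1) \<in> cyc_boundary N S" using b[of "e - 1"] e we by simp
    moreover have "?f (N - 1) \<in> cyc_boundary N S"
      using b[of "N - 1"] last j f0 N offset_eq_iff[of N y N 0] by simp
    ultimately have "?f ` {w - 1, e - 1, N - 1} \<subseteq> cyc_boundary N S" by auto
    then have "card (?f ` {w - 1, e - 1, N - 1}) \<le> 2" unfolding two[symmetric] by (intro card_mono) auto
    moreover have "card (?f ` {w - 1, e - 1, N - 1}) = card {w - 1, e - 1, N - 1}"
      using we e that wN by (intro card_image inj_on_subset[OF offset_inj]) auto
    moreover have "e < N" "e \<noteq> N" using e that by auto
    moreover have "e - 1 \<noteq> N - 1" using we \<open>e < N\<close> by simp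
    moreover have "w - 1 \<noteq> e - 1" "w - 1 \<noteq> N - 1" using we w0 wN by auto
    ultimately show False by simp
  qed
  have "S = ?f ` {..<w}"
  proof (intro equalityI subsetI)
    fix i assume i: "i \<in> S"
    then obtain d where "d < N" "i = ?f d" using S offset_surj by (metis subsetD)
    then show "i \<in> ?f ` {..<w}" using after[of d] i by force
  qed (use w in auto)
  then have arc: "S = arc N y w" using wN by (simp add: arc_eq_offset)
  have "card S = w" unfolding arc using wN by (intro card_arc) simp
  then show thesis using that[OF y(1)] arc by metis
qed

text \<open>Only the edges labelled by \<open>x\<close> and by its predecessor change. Each one
  toggles: afterwards it is a boundary edge exactly if the neighbour at its other end is
  absent.\<close>

lemma cyc_boundary_insert:
  assumes "3 \<le> N" "x \<in> {1..int N}" "x \<notin> S"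
  shows "int (card (cyc_boundary N (insert x S))) =
    int (card (cyc_boundary N S)) + 2 - 2 * of_bool (cprev N x \<in> S) - 2 * of_bool (cnext N x \<in> S)"
proof -
  have sum: "int (card (cyc_boundary N T)) = (\<Sum>i\<in>{1..int N}. of_bool ((i \<in> T) \<noteq> (cnext N i \<in> T)))" for T
    by (simp add: cyc_boundary_def Int_def)
  define p where "p = cprev N x"
  have p: "p \<in> {1..int N}" "cnext N p = x" "p \<noteq> x" "cnext N x \<noteq> x"
    using assms by (auto simp: p_def cprev_def cnext_def)
  let ?R = "{1..int N} - {x, p}"
  have split: "(\<Sum>i\<in>{1..int N}. g i) = g x + g p + (\<Sum>i\<in>?R. g i)" for g :: "int \<Rightarrow> int"
  proof -
    have "{1..int N} = insert x (insert p ?R)" using assms p by blast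
    then have "(\<Sum>i\<in>{1..int N}. g i) = sum g (insert x (insert p ?R))" by simp
    then show ?thesis using p by simp
  qed
  have rest: "(\<Sum>i\<in>?R. of_bool ((i \<in> insert x S) \<noteq> (cnext N i \<in> insert x S)) :: int)
     = (\<Sum>i\<in>?R. of_bool ((i \<in> S) \<noteq> (cnext N i \<in> S)))"
  proof (rule sum.cong)
    fix i assume i: "i \<in> ?R"
    then have "cnext N i \<noteq> x" using cprev_cnext[of i N] by (auto simp: p_def)
    then show "of_bool ((i \<in> insert x S) \<noteq> (cnext N i \<in> insert x S)) = (of_bool ((i \<in> S) \<noteq> (cnext N i \<in> S)) :: int)"
      using i by auto
  qed simp
  show ?thesis unfolding sum split rest using p assms by (auto simp: p_def[symmetric])
qed

section \<open>Energy of a set of plus sites\<close>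

definition row :: "site set \<Rightarrow> int \<Rightarrow> int set" where
  "row X j = {i. (i, j) \<in> X}"

definition col :: "site set \<Rightarrow> int \<Rightarrow> int set" where
  "col X i = {j. (i, j) \<in> X}"

lemma mem_row [simp]: "i \<in> row X j \<longleftrightarrow> (i, j) \<in> X"
  by (simp add: row_def)

lemma mem_col [simp]: "j \<in> col X i \<longleftrightarrow> (i, j) \<in> X"
  by (simp add: col_def)

text \<open>Horizontal boundary edges are counted row by row and vertical ones column by column, so
  that the bounds for a cycle apply to each line separately.\<close>

definition perimeter :: "nat \<Rightarrow> site set \<Rightarrow> int" where
  "perimeter N X = (\<Sum>j\<in>{1..int N}. int (card (cyc_boundary N (row X j))))
     + (\<Sum>i\<in>{1..int N}. int (card (cyc_boundary N (col X i))))"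

text \<open>\<open>C\<close> and \<open>D\<close> are the sets of columns of A and B. They are
  parameters so that the two fields can be exchanged when complements are taken.\<close>

definition energy :: "nat \<Rightarrow> nat \<Rightarrow> int set \<Rightarrow> int set \<Rightarrow> site set \<Rightarrow> int" where
  "energy N n C D X = int n * perimeter N X
     - 2 * int (card (X \<inter> C \<times> {1..int N})) + 2 * int (card (X \<inter> D \<times> {1..int N}))"

section \<open>The Hamiltonian in terms of boundary edges\<close>

lemma finite_torus [simp]: "finite (torus N)"
  by (simp add: torus_def)

lemma card_cyc_boundary:
  "int (card (cyc_boundary N T)) = (\<Sum>i\<in>{1..int N}. of_bool ((i \<in> T) \<noteq> (cnext N i \<in> T)))"
  by (simp add: cyc_boundary_def Int_def)

text \<open>Labels an edge by the endpoint whose vertical or horizontal successor is the other end,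
  replacing unordered pairs by two copies of the vertex set.\<close>

lemma torus_edges_eq:
  assumes "2 \<le> N"
  shows "torus_edges N = (\<lambda>x. {x, (fst x, cnext N (snd x))}) ` torus N
    \<union> (\<lambda>x. {x, (cnext N (fst x), snd x)}) ` torus N" (is "_ = ?V ` _ \<union> ?W ` _")
proof (intro equalityI subsetI)
  fix e assume "e \<in> torus_edges N"
  then obtain x y where e: "e = {x, y}" "x \<in> torus N" "y \<in> torus N"
     "fst x = fst y \<and> (snd y - snd x) mod int N = 1 \<or> snd x = snd y \<and> (fst y - fst x) mod int N = 1"
    unfolding torus_edges_def by blast
  then have "y = (fst x, cnext N (snd x)) \<or> y = (cnext N (fst x), snd x)"
    using cnext_eq_iff_mod[of "snd x" N "snd y"] cnext_eq_iff_mod[of "fst x" N "fst y"] assms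
    by (auto simp: torus_def)
  then show "e \<in> ?V ` torus N \<union> ?W ` torus N" using e by auto
next
  fix e assume "e \<in> ?V ` torus N \<union> ?W ` torus N"
  then obtain x y where x: "x \<in> torus N" and e: "e = {x, y}"
    and y: "y = (fst x, cnext N (snd x)) \<or> y = (cnext N (fst x), snd x)" by auto
  have yt: "y \<in> torus N" using x y cnext_in by (auto simp: torus_def)
  then have "fst x = fst y \<and> (snd y - snd x) mod int N = 1 \<or> snd x = snd y \<and> (fst y - fst x) mod int N = 1"
    using x y cnext_eq_iff_mod[of "snd x" N "snd y"] cnext_eq_iff_mod[of "fst x" N "fst y"] assms
    by (auto simp: torus_def)
  then show "e \<in> torus_edges N" unfolding torus_edges_def using e x yt by blast
qed

lemma sum_torus_edges:
  fixes \<sigma> :: conf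
  assumes N: "3 \<le> N"
  shows "(\<Sum>e\<in>torus_edges N. \<Prod>x\<in>e. \<sigma> x) =
    (\<Sum>(i, j)\<in>torus N. \<sigma> (i, j) * \<sigma> (cnext N i, j)) + (\<Sum>(i, j)\<in>torus N. \<sigma> (i, j) * \<sigma> (i, cnext N j))"
proof -
  let ?V = "\<lambda>x. {x, (fst x, cnext N (snd x))}"
  let ?W = "\<lambda>x. {x, (cnext N (fst x), snd x)}"
  have ne: "cnext N i \<noteq> i" "i \<noteq> cnext N i" for i using N by (auto simp: cnext_def)
  \<comment> \<open>This is where a cycle of length at least three matters: on a cycle of length two
    both endpoints would label the same edge.\<close>
  have tw: "cnext N (cnext N i) \<noteq> i" if "1 \<le> i" "i \<le> int N" for i
    using N that by (auto simp: cnext_def split: if_splits)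
  have injV: "inj_on ?V (torus N)" and injW: "inj_on ?W (torus N)"
    using tw by (auto simp: inj_on_def doubleton_eq_iff torus_def) metis+
  have disj: "?V ` torus N \<inter> ?W ` torus N = {}"
    using ne by (auto simp: doubleton_eq_iff)
  have "(\<Sum>e\<in>torus_edges N. \<Prod>x\<in>e. \<sigma> x) =
    (\<Sum>e\<in>?V ` torus N. \<Prod>x\<in>e. \<sigma> x) + (\<Sum>e\<in>?W ` torus N. \<Prod>x\<in>e. \<sigma> x)"
    using N disj by (simp add: torus_edges_eq sum.union_disjoint)
  also have "(\<Sum>e\<in>?V ` torus N. \<Prod>x\<in>e. \<sigma> x) = (\<Sum>(i, j)\<in>torus N. \<sigma> (i, j) * \<sigma> (i, cnext N j))"
    unfolding sum.reindex[OF injV] using ne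
    by (intro sum.cong refl) (auto simp: case_prod_beta prod_eq_iff)
  also have "(\<Sum>e\<in>?W ` torus N. \<Prod>x\<in>e. \<sigma> x) = (\<Sum>(i, j)\<in>torus N. \<sigma> (i, j) * \<sigma> (cnext N i, j))"
    unfolding sum.reindex[OF injW] using ne
    by (intro sum.cong refl) (auto simp: case_prod_beta prod_eq_iff)
  finally show ?thesis by simp
qed

lemma perimeter_sum:
  "perimeter N X = (\<Sum>(i, j)\<in>torus N. of_bool (((i, j) \<in> X) \<noteq> ((cnext N i, j) \<in> X)))
    + (\<Sum>(i, j)\<in>torus N. of_bool (((i, j) \<in> X) \<noteq> ((i, cnext N j) \<in> X)))"
proof -
  have "(\<Sum>(i, j)\<in>torus N. of_bool (((i, j) \<in> X) \<noteq> ((cnext N i, j) \<in> X)))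
      = (\<Sum>j\<in>{1..int N}. int (card (cyc_boundary N (row X j))))"
    unfolding torus_def card_cyc_boundary row_def
    by (subst sum.cartesian_product[symmetric], subst sum.swap) (intro sum.cong refl, simp)
  moreover have "(\<Sum>(i, j)\<in>torus N. of_bool (((i, j) \<in> X) \<noteq> ((i, cnext N j) \<in> X)))
      = (\<Sum>i\<in>{1..int N}. int (card (cyc_boundary N (col X i))))"
    unfolding torus_def card_cyc_boundary col_def
    by (subst sum.cartesian_product[symmetric]) (intro sum.cong refl, simp)
  ultimately show ?thesis by (simp add: perimeter_def)
qed

lemma conf_of_in_configs: "conf_of N X \<in> configs N"
  by (auto simp: conf_of_def configs_def)

lemma conf_of_plus_sites:
  assumes "\<sigma> \<in> configs N" shows "conf_of N {x \<in> torus N. \<sigma> x = 1} = \<sigma>"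
proof
  fix x
  show "conf_of N {x \<in> torus N. \<sigma> x = 1} x = \<sigma> x"
    using assms PiE_mem[of \<sigma> "torus N" "\<lambda>_. {-1, 1}" x] PiE_arb[of \<sigma> "torus N" "\<lambda>_. {-1, 1}" x]
    by (auto simp: conf_of_def configs_def)
qed

lemma all_minus_conf_of: "all_minus N = conf_of N {}"
  by (simp add: all_minus_def conf_of_def)

lemma all_plus_conf_of: "all_plus N = conf_of N (torus N)"
  by (auto simp: all_plus_def conf_of_def)

lemma sum_conf_of:
  assumes "F \<subseteq> torus N"
  shows "(\<Sum>x\<in>F. conf_of N X x) = 2 * real (card (X \<inter> F)) - real (card F)"
proof -
  have fin: "finite F" using assms finite_subset[OF _ finite_torus] by blast
  have "(\<Sum>x\<in>F. conf_of N X x) = (\<Sum>x\<in>F. 2 * of_bool (x \<in> X) - 1)"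
    using assms by (intro sum.cong refl) (auto simp: conf_of_def)
  also have "\<dots> = 2 * real (card (X \<inter> F)) - real (card F)"
    using fin by (simp add: sum_subtractf flip: sum_distrib_left) (simp add: Int_commute Int_def)
  finally show ?thesis .
qed

text \<open>A product of two signs is 1 minus twice the indicator of disagreement. With coupling n /
  2 each boundary edge therefore costs n, and flipping a site of A or B to plus changes the field
  term by -2 or +2.\<close>

lemma hamiltonian_conf_of:
  assumes N: "3 \<le> N" and C: "C \<subseteq> {1..int N}" and D: "D \<subseteq> {1..int N}" and X: "X \<subseteq> torus N"
  shows "hamiltonian N (C \<times> {1..int N}) (D \<times> {1..int N}) (real n) (conf_of N X) =
    hamiltonian N (C \<times> {1..int N}) (D \<times> {1..int N}) (real n) (all_minus N) + of_int (energy N n C D X)"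
proof -
  let ?\<sigma> = "\<lambda>X. conf_of N X"
  have pr: "?\<sigma> X x * ?\<sigma> X y = 1 - 2 * real_of_int (of_bool ((x \<in> X) \<noteq> (y \<in> X)))"
    if "x \<in> torus N" "y \<in> torus N" for X x y
    using that by (auto simp: conf_of_def)
  have next_in: "(cnext N i, j) \<in> torus N \<and> (i, cnext N j) \<in> torus N" if "(i, j) \<in> torus N" for i j
    using that cnext_in by (auto simp: torus_def)
  have "(\<Sum>(i, j)\<in>torus N. ?\<sigma> X (i, j) * ?\<sigma> X (cnext N i, j)) =
      (\<Sum>x\<in>torus N. 1 - 2 * real_of_int (case x of (i, j) \<Rightarrow> of_bool (((i, j) \<in> X) \<noteq> ((cnext N i, j) \<in> X))))" for X
    using next_in pr by (intro sum.cong) auto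
  moreover have "(\<Sum>(i, j)\<in>torus N. ?\<sigma> X (i, j) * ?\<sigma> X (i, cnext N j)) =
      (\<Sum>x\<in>torus N. 1 - 2 * real_of_int (case x of (i, j) \<Rightarrow> of_bool (((i, j) \<in> X) \<noteq> ((i, cnext N j) \<in> X))))" for X
    using next_in pr by (intro sum.cong) auto
  ultimately have e: "(\<Sum>e\<in>torus_edges N. \<Prod>x\<in>e. ?\<sigma> X x) = 2 * real (card (torus N)) - 2 * of_int (perimeter N X)" for X
    by (simp add: sum_torus_edges[OF N] perimeter_sum sum_subtractf sum_distrib_left[symmetric])
  have sub: "C \<times> {1..int N} \<subseteq> torus N" "D \<times> {1..int N} \<subseteq> torus N" using C D by (auto simp: torus_def)
  have "perimeter N {} = 0" by (simp add: perimeter_def cyc_boundary_def row_def col_def)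
  then show ?thesis
    by (simp add: hamiltonian_def all_minus_conf_of sum_conf_of[OF sub(1)] sum_conf_of[OF sub(2)] e energy_def algebra_simps)
qed

lemma perimeter_insert:
  assumes "3 \<le> N" "(i, j) \<in> torus N" "(i, j) \<notin> X"
  shows "perimeter N (insert (i, j) X) = perimeter N X + 4
    - 2 * (of_bool ((cprev N i, j) \<in> X) + of_bool ((cnext N i, j) \<in> X)
      + of_bool ((i, cprev N j) \<in> X) + of_bool ((i, cnext N j) \<in> X))"
proof -
  have r: "row (insert (i, j) X) j' = (if j' = j then insert i (row X j) else row X j')" for j'
    by (auto simp: row_def)
  have c: "col (insert (i, j) X) i' = (if i' = i then insert j (col X i) else col X i')" for i'
    by (auto simp: col_def)
  have ij: "i \<in> {1..int N}" "j \<in> {1..int N}" using assms by (auto simp: torus_def)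
  have nr: "i \<notin> row X j" "j \<notin> col X i" using assms by (auto simp: row_def col_def)
  have "(\<Sum>j'\<in>{1..int N}. int (card (cyc_boundary N (row (insert (i, j) X) j')))) =
    (\<Sum>j'\<in>{1..int N}. int (card (cyc_boundary N (row X j')))) +
      2 - 2 * of_bool ((cprev N i, j) \<in> X) - 2 * of_bool ((cnext N i, j) \<in> X)"
    unfolding sum.remove[OF finite_atLeastAtMost_int ij(2)]
    using cyc_boundary_insert[OF assms(1) ij(1) nr(1)] by (simp add: r)
  moreover have "(\<Sum>i'\<in>{1..int N}. int (card (cyc_boundary N (col (insert (i, j) X) i')))) =
    (\<Sum>i'\<in>{1..int N}. int (card (cyc_boundary N (col X i')))) +
      2 - 2 * of_bool ((i, cprev N j) \<in> X) - 2 * of_bool ((i, cnext N j) \<in> X)"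
    unfolding sum.remove[OF finite_atLeastAtMost_int ij(1)]
    using cyc_boundary_insert[OF assms(1) ij(2) nr(2)] by (simp add: c)
  ultimately show ?thesis by (simp add: perimeter_def)
qed

lemma energy_insert:
  assumes "3 \<le> N" "(i, j) \<in> torus N" "(i, j) \<notin> X" "X \<subseteq> torus N"
  shows "energy N n C D (insert (i, j) X) = energy N n C D X
    + int n * (4 - 2 * (of_bool ((cprev N i, j) \<in> X) + of_bool ((cnext N i, j) \<in> X)
      + of_bool ((i, cprev N j) \<in> X) + of_bool ((i, cnext N j) \<in> X)))
    - 2 * of_bool (i \<in> C) + 2 * of_bool (i \<in> D)"
proof -
  have fin: "finite X" using assms(4) finite_subset[OF _ finite_torus] by blast
  have "int (card (insert (i, j) X \<inter> F \<times> {1..int N})) = int (card (X \<inter> F \<times> {1..int N})) + of_bool (i \<in> F)" for F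
    using assms fin by (simp add: Int_insert_left torus_def)
  then show ?thesis
    by (simp add: energy_def perimeter_insert[OF assms(1-3)] algebra_simps)
qed

lemma perimeter_compl:
  assumes "X \<subseteq> torus N" shows "perimeter N (torus N - X) = perimeter N X"
proof -
  have "cyc_boundary N (row (torus N - X) j) = cyc_boundary N (row X j)" if "j \<in> {1..int N}" for j
    using that cyc_boundary_compl[of N "row X j"] by (simp add: row_def torus_def set_diff_eq)
  moreover have "cyc_boundary N (col (torus N - X) i) = cyc_boundary N (col X i)" if "i \<in> {1..int N}" for i
    using that cyc_boundary_compl[of N "col X i"] by (simp add: col_def torus_def set_diff_eq)
  ultimately show ?thesis by (simp add: perimeter_def)
qed

text \<open>Complementation preserves the perimeter and turns each intersection with a strip into
  the rest of that strip. Since the strips have equal size the constants cancel, and the two fields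
  change places.\<close>

lemma energy_compl:
  assumes "X \<subseteq> torus N" "C \<subseteq> {1..int N}" "D \<subseteq> {1..int N}" "card C = card D"
  shows "energy N n C D (torus N - X) = energy N n D C X"
proof -
  have "int (card ((torus N - X) \<inter> F \<times> {1..int N})) = int (card F) * int N - int (card (X \<inter> F \<times> {1..int N}))"
    if "F \<subseteq> {1..int N}" for F
  proof -
    have fin: "finite F" using that finite_subset by blast
    have "(torus N - X) \<inter> F \<times> {1..int N} = F \<times> {1..int N} - X \<inter> F \<times> {1..int N}"
      using that by (auto simp: torus_def)
    then have "card ((torus N - X) \<inter> F \<times> {1..int N}) = card (F \<times> {1..int N}) - card (X \<inter> F \<times> {1..int N})"
      using fin by (simp add: card_Diff_subset)
    moreover have "card (X \<inter> F \<times> {1..int N}) \<le> card (F \<times> {1..int N})"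
      using fin by (intro card_mono) auto
    ultimately show ?thesis by (simp add: card_cartesian_product of_nat_diff)
  qed
  then show ?thesis using assms by (simp add: energy_def perimeter_compl)
qed

section \<open>Lower bounds on the energy\<close>

lemma card_torus_subset_rows:
  assumes "Y \<subseteq> torus N" shows "int (card Y) = (\<Sum>j\<in>{1..int N}. int (card (row Y j)))"
proof -
  have inner: "(\<Sum>i\<in>{1..int N}. of_bool ((i, j) \<in> Y)) = int (card (row Y j))" for j
  proof -
    have "{1..int N} \<inter> {i. (i, j) \<in> Y} = row Y j" using assms by (auto simp: torus_def)
    then show ?thesis by simp
  qed
  have "int (card Y) = (\<Sum>x\<in>torus N. of_bool (x \<in> Y))"
    using assms by (simp add: Int_absorb1)
  also have "\<dots> = (\<Sum>j\<in>{1..int N}. \<Sum>i\<in>{1..int N}. of_bool ((i, j) \<in> Y))"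
    unfolding torus_def by (subst sum.swap, subst sum.cartesian_product) (simp add: case_prod_beta)
  finally show ?thesis by (simp only: inner)
qed

lemma card_torus_subset_cols:
  assumes "Y \<subseteq> torus N" shows "int (card Y) = (\<Sum>i\<in>{1..int N}. int (card (col Y i)))"
proof -
  have "row (prod.swap ` Y) i = col Y i" for i by (auto simp: set_eq_iff)
  moreover have "prod.swap ` Y \<subseteq> torus N" using assms by (auto simp: torus_def)
  ultimately show ?thesis
    using card_torus_subset_rows[of "prod.swap ` Y" N] by (simp add: card_image)
qed

lemma row_empty: "j \<notin> snd ` X \<Longrightarrow> row X j = {}"
  by (force simp: row_def)

lemma col_empty: "i \<notin> fst ` X \<Longrightarrow> col X i = {}"
  by (force simp: col_def)

lemma row_subset: "row X j \<subseteq> fst ` X"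
  by (force simp: row_def)

lemma col_subset: "col X i \<subseteq> snd ` X"
  by (force simp: col_def)

lemma cyc_boundary_empty [simp]: "cyc_boundary N {} = {}"
  by (simp add: cyc_boundary_def)

lemma cyc_boundary_full [simp]: "cyc_boundary N {1..int N} = {}"
  using cnext_in by (auto simp: cyc_boundary_def)

lemma fst_torus: "X \<subseteq> torus N \<Longrightarrow> fst ` X \<subseteq> {1..int N}"
  and snd_torus: "X \<subseteq> torus N \<Longrightarrow> snd ` X \<subseteq> {1..int N}"
  by (auto simp: torus_def)

lemma perimeter_projections:
  assumes "X \<subseteq> torus N"
  shows "perimeter N X = (\<Sum>j\<in>snd ` X. int (card (cyc_boundary N (row X j))))
     + (\<Sum>i\<in>fst ` X. int (card (cyc_boundary N (col X i))))"
  unfolding perimeter_def using assms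
  by (intro arg_cong2[of _ _ _ _ "(+)"] sum.mono_neutral_right)
     (simp_all add: fst_torus snd_torus row_empty col_empty)

text \<open>Charging the field to the rows sets the boundary cost of a row against its own gain of
  at most 2n, as needed when a row is opened.\<close>

lemma energy_by_rows:
  assumes X: "X \<subseteq> torus N"
  shows "energy N n C D X = (\<Sum>j\<in>snd ` X. int n * int (card (cyc_boundary N (row X j)))
      - 2 * int (card (row X j \<inter> C)) + 2 * int (card (row X j \<inter> D)))
    + int n * (\<Sum>i\<in>fst ` X. int (card (cyc_boundary N (col X i))))"
proof -
  have "int (card (X \<inter> F \<times> {1..int N})) = (\<Sum>j\<in>snd ` X. int (card (row X j \<inter> F)))" for F
  proof -
    have "int (card (X \<inter> F \<times> {1..int N})) = (\<Sum>j\<in>{1..int N}. int (card (row (X \<inter> F \<times> {1..int N}) j)))"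
      using X by (intro card_torus_subset_rows) auto
    also have "\<dots> = (\<Sum>j\<in>{1..int N}. int (card (row X j \<inter> F)))"
      by (intro sum.cong refl arg_cong[of _ _ "\<lambda>Y. int (card Y)"]) auto
    also have "\<dots> = (\<Sum>j\<in>snd ` X. int (card (row X j \<inter> F)))"
      using snd_torus[OF X] by (intro sum.mono_neutral_right) (auto simp: row_empty)
    finally show ?thesis .
  qed
  then show ?thesis
    by (simp add: energy_def perimeter_projections[OF X] sum.distrib sum_subtractf sum_distrib_left algebra_simps)
qed

text \<open>Here the field is charged to the columns, which suits the opening of a column and the
  estimate for narrow sets.\<close>

lemma energy_by_cols:
  assumes X: "X \<subseteq> torus N"
  shows "energy N n C D X = (\<Sum>i\<in>fst ` X. int n * int (card (cyc_boundary N (col X i)))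
      - 2 * (of_bool (i \<in> C) - of_bool (i \<in> D)) * int (card (col X i)))
    + int n * (\<Sum>j\<in>snd ` X. int (card (cyc_boundary N (row X j))))"
proof -
  have "int (card (X \<inter> F \<times> {1..int N})) = (\<Sum>i\<in>fst ` X. of_bool (i \<in> F) * int (card (col X i)))" for F
  proof -
    have "int (card (X \<inter> F \<times> {1..int N})) = (\<Sum>i\<in>{1..int N}. int (card (col (X \<inter> F \<times> {1..int N}) i)))"
      using X by (intro card_torus_subset_cols) auto
    also have "\<dots> = (\<Sum>i\<in>{1..int N}. of_bool (i \<in> F) * int (card (col X i)))"
    proof (intro sum.cong refl)
      fix i
      have "col (X \<inter> F \<times> {1..int N}) i = (if i \<in> F then col X i else {})"
        using X by (auto simp: torus_def)
      then show "int (card (col (X \<inter> F \<times> {1..int N}) i)) = of_bool (i \<in> F) * int (card (col X i))" by simp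
    qed
    also have "\<dots> = (\<Sum>i\<in>fst ` X. of_bool (i \<in> F) * int (card (col X i)))"
      using fst_torus[OF X] by (intro sum.mono_neutral_right) (auto simp: col_empty)
    finally show ?thesis .
  qed
  then show ?thesis
    by (simp add: energy_def perimeter_projections[OF X] sum.distrib sum_subtractf sum_distrib_left algebra_simps)
qed

lemma card_lt_not_full: "card S < N \<Longrightarrow> T \<subseteq> S \<Longrightarrow> finite S \<Longrightarrow> T \<noteq> {1..int N}"
  using card_mono[of S T] by auto

lemma col_boundary_ge_2:
  assumes X: "X \<subseteq> torus N" and i: "i \<in> fst ` X" and r: "card (snd ` X) < N"
  shows "2 \<le> int (card (cyc_boundary N (col X i)))"
proof -
  have "finite X" using X finite_subset[OF _ finite_torus] by blast
  then have "col X i \<noteq> {1..int N}" by (intro card_lt_not_full[OF r col_subset]) simp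
  moreover have "col X i \<noteq> {}" using i by (force simp: col_def)
  moreover have "col X i \<subseteq> {1..int N}" using col_subset snd_torus[OF X] by blast
  ultimately show ?thesis using cyc_boundary_ge_2[of "col X i" N] by simp
qed

lemma row_boundary_ge_2:
  assumes X: "X \<subseteq> torus N" and j: "j \<in> snd ` X" and c: "card (fst ` X) < N"
  shows "2 \<le> int (card (cyc_boundary N (row X j)))"
proof -
  have "finite X" using X finite_subset[OF _ finite_torus] by blast
  then have "row X j \<noteq> {1..int N}" by (intro card_lt_not_full[OF c row_subset]) simp
  moreover have "row X j \<noteq> {}" using j by (force simp: row_def)
  moreover have "row X j \<subseteq> {1..int N}" using row_subset fst_torus[OF X] by blast
  ultimately show ?thesis using cyc_boundary_ge_2[of "row X j" N] by simp
qed

section \<open>A single index attached to an arc\<close>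

lemma offset_zero_eq: "offset N (y + int d) 0 = offset N y d"
  by (simp add: offset_def)

lemma arc_single: "0 < N \<Longrightarrow> arc N x 1 = {offset N x 0}"
  by (subst arc_eq_offset) auto

text \<open>An unchanged boundary count means that exactly one neighbour of \<open>z\<close> lies in
  the arc. A predecessor in the arc puts \<open>z\<close> at parameter \<open>a\<close>, a successor
  puts it at parameter N - 1, which is y - 1 on the cycle. The index \<open>z'\<close> stays
  unreduced, as in \<open>bar_rects\<close>.\<close>

lemma adjacent_to_arc:
  assumes N: "3 \<le> N" and a: "1 \<le> a" "a \<le> N" and z: "z \<in> {1..int N}" "z \<notin> arc N y a"
    and b: "card (cyc_boundary N (arc N y a)) = 2" "card (cyc_boundary N (insert z (arc N y a))) = 2"
  obtains z' where "z' = y + int a \<or> z' = y - 1" "arc N z' 1 = {z}"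
proof -
  obtain d where d: "d < N" "z = offset N y d" using offset_surj[OF z(1)] by metis
  have da: "a \<le> d" using z(2) d a by (auto simp: arc_eq_offset not_le[symmetric])
  have "cprev N z \<in> arc N y a \<or> cnext N z \<in> arc N y a"
    using cyc_boundary_insert[OF N z] b by (auto split: if_splits)
  then show thesis
  proof
    assume "cprev N z \<in> arc N y a"
    then obtain e where e: "e < a" "cprev N z = offset N y e" using a by (auto simp: arc_eq_offset)
    then have "z = offset N y (Suc e)" using cnext_cprev[OF z(1)] cnext_offset[of N] N by simp
    moreover from this have "d = Suc e" using d e a offset_eq_iff[of N y d "Suc e"] da
      by (cases "Suc e < N") auto
    moreover have "a = Suc e" using e da calculation by simp
    ultimately have "z = offset N y a" by simp
    then show thesis using that[of "y + int a"] N arc_single[of N "y + int a"]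
      by (simp add: offset_zero_eq)
  next
    assume "cnext N z \<in> arc N y a"
    then obtain e where e: "e < a" "offset N y (Suc d) = offset N y e"
      using a N cnext_offset[of N y d] by (auto simp: arc_eq_offset d)
    then have "Suc d mod N = e" using a by (simp add: offset_eq_iff)
    then have "d = N - 1" using e da d by (cases "Suc d < N") auto
    moreover have "offset N (y - 1) 0 = offset N y (N - 1)"
    proof -
      have "y + int (N - 1) - 1 = y - 2 + int N" using N by (simp add: of_nat_diff)
      then show ?thesis unfolding offset_def by (simp only: mod_add_self2) simp
    qed
    ultimately show thesis using that[of "y - 1"] N arc_single[of N "y - 1"] d by simp
  qed
qed

section \<open>Minimal energy when a row or a column is opened\<close>

definition barrier :: "nat \<Rightarrow> int" where
  "barrier n = 2 * int n * int n + 2 * int n - 2"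

text \<open>\<open>C\<close> and \<open>D\<close> are the columns of A and B; \<open>N_ge\<close> is
  what k >= 1 and m >= n give. When \<open>card D = n\<close> the assumptions are symmetric, so the
  locale can be interpreted again with \<open>C\<close> and \<open>D\<close> exchanged; the
  statements about B rest on this.\<close>

locale opposing_strips =
  fixes N n :: nat and C D :: "int set"
  assumes N_ge: "2 * n + 2 \<le> N" and n_ge: "3 \<le> n"
    and C_sub: "C \<subseteq> {1..int N}" and D_sub: "D \<subseteq> {1..int N}" and CD: "C \<inter> D = {}"
    and card_C: "card C = n" and card_D: "n \<le> card D"
begin

abbreviation b :: "int set \<Rightarrow> int" where "b S \<equiv> int (card (cyc_boundary N S))"
abbreviation E :: "site set \<Rightarrow> int" where "E \<equiv> energy N n C D"

lemma finite_CD [simp]: "finite C" "finite D"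
  using C_sub D_sub finite_subset by blast+

text \<open>The bounds 2n - 2 for row \<open>z\<close>, 0 for each other row and 2n^2 for the
  columns add up to the barrier, hence all are equalities. So there are exactly n columns, every row
  in \<open>J\<close> contains \<open>C\<close>, and every column has two boundary edges.\<close>

lemma row_crossing:
  assumes X: "X \<subseteq> torus N" and rows: "snd ` X = insert z J" "z \<notin> J" "J \<noteq> {}"
    and rz: "row X z = {t}" and r: "card (snd ` X) \<le> N - 1" and c: "n \<le> card (fst ` X)"
    and E: "E X \<le> barrier n"
  shows "X = C \<times> J \<union> {(t, z)}" "t \<in> C" "b J = 2" "b (insert z J) = 2"
proof -
  have fin: "finite X" using X finite_subset[OF _ finite_torus] by blast
  have finJ: "finite J" using rows fin by (metis finite_imageI finite_insert)
  have N: "3 \<le> N" using N_ge n_ge by simp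
  let ?w = "\<lambda>j. int n * b (row X j) - 2 * int (card (row X j \<inter> C)) + 2 * int (card (row X j \<inter> D))"
  have b_col: "2 \<le> b (col X i)" if "i \<in> fst ` X" for i
    using that r N_ge by (intro col_boundary_ge_2[OF X]) simp_all
  have b_row: "2 \<le> b (row X j)" if "j \<in> snd ` X" "row X j \<noteq> {1..int N}" for j
  proof -
    have "row X j \<noteq> {}" using that by (force simp: row_def)
    moreover have "row X j \<subseteq> {1..int N}" using row_subset fst_torus[OF X] by blast
    ultimately show ?thesis using that cyc_boundary_ge_2[of "row X j" N] by simp
  qed
  have wC: "card (row X j \<inter> C) \<le> n" for j using card_mono[of C "row X j \<inter> C"] card_C by simp
  have nb: "2 * int n \<le> int n * b (row X j)" if "j \<in> snd ` X" "row X j \<noteq> {1..int N}" for j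
    using mult_left_mono[OF b_row[OF that], of "int n"] by simp
  \<comment> \<open>A full row has no boundary, but it contains at least as many sites of B as of A.
    Any other row pays at least 2n and gains at most 2n.\<close>
  have w_nonneg: "0 \<le> ?w j" if "j \<in> snd ` X" for j
  proof (cases "row X j = {1..int N}")
    case True
    then show ?thesis using C_sub D_sub card_C card_D by (simp add: Int_absorb1)
  next
    case False
    then show ?thesis using nb[OF that] wC[of j] by simp
  qed
  have w_z: "2 * int n - 2 \<le> ?w z"
  proof -
    have "row X z \<noteq> {1..int N}"
      unfolding rz using N by (intro card_lt_not_full[of "{t}"]) simp_all
    then have "2 * int n \<le> int n * b (row X z)" using nb rows by blast
    moreover have "card (row X z \<inter> C) \<le> 1" unfolding rz using card_mono[of "{t}" "{t} \<inter> C"] by simp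
    ultimately show ?thesis by simp
  qed
  define SB where "SB = (\<Sum>i\<in>fst ` X. b (col X i))"
  define SJ where "SJ = (\<Sum>j\<in>J. ?w j)"
  have en: "E X = ?w z + SJ + int n * SB"
    unfolding energy_by_rows[OF X] SB_def SJ_def rows(1) using rows finJ by simp
  have SJ: "0 \<le> SJ" unfolding SJ_def using w_nonneg rows by (intro sum_nonneg) auto
  have SB: "2 * int (card (fst ` X)) \<le> SB"
    using sum_mono[of "fst ` X" "\<lambda>_. 2" "\<lambda>i. b (col X i)"] b_col by (simp add: SB_def)
  have SBn: "2 * int n \<le> SB" using SB c by simp
  have n0: "0 < int n" using n_ge by simp
  have nSB: "int n * (2 * int n) \<le> int n * SB" using SBn by (intro mult_left_mono) auto
  have "int n * SB \<le> int n * (2 * int n)" using E en SJ w_z by (simp add: barrier_def)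
  then have SB_eq: "SB = 2 * int n" using SBn n0 by simp
  then have c_eq: "card (fst ` X) = n" using SB c by simp
  have "SJ = 0" using E en SJ w_z nSB by (simp add: barrier_def)
  then have w0: "?w j = 0" if "j \<in> J" for j
    using that sum_nonneg_eq_0_iff[OF finJ, of ?w] w_nonneg rows unfolding SJ_def by blast
  have "(\<Sum>i\<in>fst ` X. b (col X i) - 2) = 0"
    using SB_eq c_eq by (simp add: SB_def sum_subtractf)
  then have b2: "b (col X i) = 2" if "i \<in> fst ` X" for i
    using that sum_nonneg_eq_0_iff[of "fst ` X" "\<lambda>i. b (col X i) - 2"] b_col fin by fastforce
  \<comment> \<open>With only n occupied columns no row is full, so a row of cost zero must gain
    back its 2n and therefore covers \<open>C\<close>.\<close>
  have row_J: "C \<subseteq> row X j" if "j \<in> J" for j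
  proof -
    have nf: "row X j \<noteq> {1..int N}"
      using c_eq N_ge fin by (intro card_lt_not_full[OF _ row_subset]) auto
    have "n \<le> card (row X j \<inter> C)" using nb[OF _ nf] w0[OF that] rows that by force
    then have "row X j \<inter> C = C" using wC card_C by (intro card_subset_eq) (auto simp: le_antisym)
    then show ?thesis by blast
  qed
  obtain j0 where j0: "j0 \<in> J" using rows by blast
  have colsC: "fst ` X = C"
    using row_J[OF j0] row_subset[of X j0] c_eq card_C fin by (intro card_subset_eq[symmetric]) auto
  show t: "t \<in> C" using rz colsC row_subset[of X z] by auto
  show XC: "X = C \<times> J \<union> {(t, z)}"
  proof (intro equalityI subsetI)
    fix x assume x: "x \<in> X"
    obtain i j where ij: "x = (i, j)" by (cases x)
    have "i \<in> C" using colsC x ij by force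
    moreover have "j \<in> insert z J" using rows(1) x ij by force
    moreover have "i = t" if "j = z" using rz x ij that by (auto simp: row_def)
    ultimately show "x \<in> C \<times> J \<union> {(t, z)}" using ij by auto
  next
    fix x assume "x \<in> C \<times> J \<union> {(t, z)}"
    then show "x \<in> X" using row_J rz by (auto simp: row_def)
  qed
  \<comment> \<open>A column of \<open>C\<close> away from the extra site is a copy of
    \<open>J\<close>, and the column of the extra site is a copy of \<open>J\<close> with
    \<open>z\<close> added. Here n >= 2 provides both kinds.\<close>
  obtain i where i: "i \<in> C" "i \<noteq> t"
    using card_C n_ge card_mono[of "{t}" C] by fastforce
  have "col X i = J" using i rows unfolding XC by auto
  then show "b J = 2" using b2[of i] colsC i by simp
  have "col X t = insert z J" using t unfolding XC by auto
  then show "b (insert z J) = 2" using b2[of t] colsC t by simp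
qed

text \<open>With r rows, column \<open>t\<close> costs at least 2n - 2, each of the other n - 1
  columns at least 2n - 2r, and the row boundaries 2nr. The total is 2n^2 + 2r - 2, and r >= n
  leaves no room above the barrier.\<close>

lemma col_crossing:
  assumes X: "X \<subseteq> torus N" and cols: "fst ` X = insert t K" "t \<notin> K"
    and ct: "col X t = {z}" and r: "n \<le> card (snd ` X)" "card (snd ` X) \<le> N - 1"
    and c: "card (fst ` X) = n" and E: "E X \<le> barrier n"
  shows "card (snd ` X) = n" "X = K \<times> snd ` X \<union> {(t, z)}" "insert t K = C"
    "b K = 2" "b (insert t K) = 2" "b (snd ` X) = 2"
proof -
  let ?R = "snd ` X"
  have fin: "finite X" using X finite_subset[OF _ finite_torus] by blast
  have finK: "finite K" using cols fin by (metis finite_imageI finite_insert)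
  have cK: "int (card K) = int n - 1" using c cols finK by simp
  have b_col: "2 \<le> b (col X i)" if "i \<in> fst ` X" for i
    using that r N_ge by (intro col_boundary_ge_2[OF X]) simp_all
  have b_row: "2 \<le> b (row X j)" if "j \<in> snd ` X" for j
    using that c N_ge by (intro row_boundary_ge_2[OF X]) simp_all
  have nb: "2 * int n \<le> int n * b (col X i)" if "i \<in> fst ` X" for i
    using mult_left_mono[OF b_col[OF that], of "int n"] by simp
  have cR: "card (col X i) \<le> card ?R" for i using fin by (intro card_mono col_subset) simp
  let ?s = "\<lambda>i. of_bool (i \<in> C) - of_bool (i \<in> D) :: int"
  let ?w = "\<lambda>i. int n * b (col X i) - 2 * ?s i * int (card (col X i))"
  let ?v = "\<lambda>i. ?w i - (2 * int n - 2 * int (card ?R))"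
  have s1: "?s i * int (card (col X i)) \<le> int (card (col X i))" for i by simp
  have v: "0 \<le> ?v i" if "i \<in> fst ` X" for i
    using nb[OF that] cR[of i] s1[of i] by simp
  have w_t: "2 * int n - 2 \<le> ?w t" using nb[of t] cols ct s1[of t] by auto
  define SR where "SR = (\<Sum>j\<in>?R. b (row X j))"
  define SK where "SK = (\<Sum>i\<in>K. ?v i)"
  have "(\<Sum>i\<in>K. 2 * int n - 2 * int (card ?R)) = (int n - 1) * (2 * int n - 2 * int (card ?R))"
    unfolding sum_constant cK ..
  then have "(\<Sum>i\<in>K. ?w i) = SK + (int n - 1) * (2 * int n - 2 * int (card ?R))"
    unfolding SK_def sum_subtractf[of ?w "\<lambda>_. 2 * int n - 2 * int (card ?R)"] by linarith
  then have en: "E X = ?w t + SK + (int n - 1) * (2 * int n - 2 * int (card ?R)) + int n * SR"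
    unfolding energy_by_cols[OF X] SR_def cols(1) using cols finK by simp
  have SK: "0 \<le> SK" unfolding SK_def using v cols by (intro sum_nonneg) auto
  have SR: "2 * int (card ?R) \<le> SR"
    using sum_mono[of ?R "\<lambda>_. 2" "\<lambda>j. b (row X j)"] b_row by (simp add: SR_def)
  have nSR: "int n * (2 * int (card ?R)) \<le> int n * SR" using SR by (intro mult_left_mono) auto
  \<comment> \<open>Four nonnegative slacks with a nonpositive sum: the columns in \<open>K\<close>,
    the column \<open>t\<close>, the row boundaries, and twice the excess of the number of rows over
    n.\<close>
  have "SK + (?w t - (2 * int n - 2)) + (int n * SR - int n * (2 * int (card ?R))) + 2 * (int (card ?R) - int n) \<le> 0"
    using E en by (simp add: barrier_def algebra_simps)
  moreover have "u = 0 \<and> p = q \<and> x = y \<and> r = s"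
    if "u + (p - q) + (x - y) + 2 * (r - s) \<le> 0" "0 \<le> u" "q \<le> p" "y \<le> x" "s \<le> r" for u p q x y r s :: int
    using that by presburger
  ultimately have "SK = 0 \<and> ?w t = 2 * int n - 2 \<and> int n * SR = int n * (2 * int (card ?R)) \<and> int (card ?R) = int n"
    using SK w_t nSR r(1) of_nat_mono[OF r(1), where 'a = int] by blast
  then have eqs: "SK = 0" "?w t = 2 * int n - 2" "int n * SR = int n * (2 * int (card ?R))" "int (card ?R) = int n"
    by blast+
  show rn: "card ?R = n" using eqs by simp
  have w0: "?w i = 0" if "i \<in> K" for i
    using that sum_nonneg_eq_0_iff[OF finK, of ?v] v cols eqs rn unfolding SK_def by simp
  have SR_eq: "SR = 2 * int n" using eqs n_ge by simp
  have "(\<Sum>j\<in>?R. b (row X j) - 2) = 0" using SR_eq rn by (simp add: SR_def sum_subtractf)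
  then have b2: "b (row X j) = 2" if "j \<in> ?R" for j
    using that sum_nonneg_eq_0_iff[of ?R "\<lambda>j. b (row X j) - 2"] b_row fin by fastforce
  have K: "i \<in> C \<and> col X i = ?R \<and> b (col X i) = 2" if "i \<in> K" for i
  proof -
    have i: "i \<in> fst ` X" using cols that by auto
    have n0: "0 < int n" using n_ge by simp
    \<comment> \<open>Outside \<open>C\<close> a column gains nothing from the field, so its
      boundary cost could not be cancelled.\<close>
    have iC: "i \<in> C"
    proof (rule ccontr)
      assume "i \<notin> C"
      then have "0 \<le> - 2 * ?s i * int (card (col X i))" by simp
      then show False using w0[OF that] nb[OF i] n0 by linarith
    qed
    then have e: "int n * b (col X i) = 2 * int (card (col X i))"
      using w0[OF that] CD by auto
    then have "card (col X i) = n" using nb[OF i] cR[of i] rn by linarith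
    moreover from this have "col X i = ?R" using rn fin by (intro card_subset_eq col_subset) auto
    ultimately show ?thesis using e iC n0 by simp
  qed
  have tC: "t \<in> C"
  proof (rule ccontr)
    assume "t \<notin> C"
    then have "2 * int n \<le> ?w t" using nb[of t] cols by (cases "t \<in> D") auto
    then show False using eqs(2) by linarith
  qed
  show KC: "insert t K = C"
    using K tC c card_C cols by (intro card_subset_eq) auto
  show XK: "X = K \<times> ?R \<union> {(t, z)}"
  proof (intro equalityI subsetI)
    fix x assume x: "x \<in> X"
    obtain i j where ij: "x = (i, j)" by (cases x)
    have "i \<in> insert t K" using cols(1) x ij by force
    moreover have "j \<in> ?R" using x ij by force
    moreover have "j = z" if "i = t" using ct x ij that by (auto simp: col_def)
    ultimately show "x \<in> K \<times> ?R \<union> {(t, z)}" using ij by auto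
  next
    fix x assume "x \<in> K \<times> ?R \<union> {(t, z)}"
    then consider i j where "x = (i, j)" "i \<in> K" "j \<in> col X i" | "x = (t, z)" using K by auto
    then show "x \<in> X" using ct by cases (auto simp: col_def)
  qed
  have zX: "(t, z) \<in> X" using ct by (auto simp: col_def)
  have mem: "(i, j) \<in> X \<longleftrightarrow> i \<in> K \<and> j \<in> ?R \<or> i = t \<and> j = z" for i j
    using arg_cong[OF XK, of "\<lambda>Y. (i, j) \<in> Y"] by auto
  have zR: "z \<in> ?R" using zX by force
  have "row X z = insert t K" using zR unfolding set_eq_iff mem_row mem insert_iff by blast
  then show "b (insert t K) = 2" using b2[OF zR] by simp
  obtain j where j: "j \<in> ?R" "j \<noteq> z"
    using rn n_ge card_mono[of "{z}" ?R] by fastforce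
  have "row X j = K" using j by (auto simp: mem)
  then show "b K = 2" using b2[OF j(1)] by simp
  have "K \<noteq> {}" using cK n_ge by auto
  then show "b ?R = 2" using K by (metis ex_in_conv)
qed

text \<open>Each column gains at most 2(N - 1) - 2n net, and there are at most n - 1 of them, while
  each of the N - 1 rows costs 2n. What remains is 2n(n - 1) + 2(N - 1), above the barrier because N
  >= 2n + 2.\<close>

lemma narrow_bound:
  assumes X: "X \<subseteq> torus N" and r: "card (snd ` X) = N - 1" and c: "card (fst ` X) \<le> n - 1"
  shows "barrier n < E X"
proof -
  have fin: "finite X" using X finite_subset[OF _ finite_torus] by blast
  have b_col: "2 \<le> b (col X i)" if "i \<in> fst ` X" for i
    using that r N_ge by (intro col_boundary_ge_2[OF X]) simp_all
  have b_row: "2 \<le> b (row X j)" if "j \<in> snd ` X" for j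
    using that c N_ge by (intro row_boundary_ge_2[OF X]) simp_all
  have "(\<Sum>i\<in>fst ` X. 2 * int n - 2 * int (N - 1)) \<le>
     (\<Sum>i\<in>fst ` X. int n * b (col X i) - 2 * (of_bool (i \<in> C) - of_bool (i \<in> D)) * int (card (col X i)))"
  proof (rule sum_mono)
    fix i assume i: "i \<in> fst ` X"
    have "card (col X i) \<le> N - 1" unfolding r[symmetric] using fin by (intro card_mono col_subset) simp
    moreover have "2 * int n \<le> int n * b (col X i)"
      using mult_left_mono[OF b_col[OF i], of "int n"] by simp
    moreover have "(of_bool (i \<in> C) - of_bool (i \<in> D)) * int (card (col X i)) \<le> int (card (col X i))" by simp
    ultimately show "2 * int n - 2 * int (N - 1) \<le>
      int n * b (col X i) - 2 * (of_bool (i \<in> C) - of_bool (i \<in> D)) * int (card (col X i))" by linarith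
  qed
  \<comment> \<open>The summand is negative, so the largest admissible number of columns is the
    worst case.\<close>
  moreover have "(int n - 1) * (2 * int n - 2 * int (N - 1)) \<le> (\<Sum>i\<in>fst ` X. 2 * int n - 2 * int (N - 1))"
    using c n_ge N_ge by (simp add: mult_right_mono_neg)
  moreover have "2 * int (N - 1) \<le> (\<Sum>j\<in>snd ` X. b (row X j))"
    using sum_mono[of "snd ` X" "\<lambda>_. 2" "\<lambda>j. b (row X j)"] b_row r by simp
  then have "int n * (2 * int (N - 1)) \<le> int n * (\<Sum>j\<in>snd ` X. b (row X j))"
    by (intro mult_left_mono) auto
  ultimately have "(int n - 1) * (2 * int n - 2 * int (N - 1)) + int n * (2 * int (N - 1)) \<le> E X"
    unfolding energy_by_cols[OF X] by linarith
  moreover have "2 * int (N - 1) \<ge> 4 * int n + 2" using N_ge by simp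
  ultimately show ?thesis by (simp add: barrier_def algebra_simps)
qed

end

section \<open>Paths below the barrier meet the protuberance rectangles\<close>

definition flip_step :: "site set \<Rightarrow> site set \<Rightarrow> bool" where
  "flip_step X Y \<longleftrightarrow> (\<exists>x. x \<notin> X \<and> Y = insert x X \<or> x \<notin> Y \<and> X = insert x Y)"

lemma successively_crossing:
  assumes "successively R xs" "xs \<noteq> []" "\<not> Q (hd xs)" "Q (last xs)"
  obtains x y where "x \<in> set xs" "y \<in> set xs" "R x y" "\<not> Q x" "Q y"
  using assms
proof (induction xs arbitrary: thesis rule: induct_list012)
  case (3 x y zs)
  show ?case
  proof (cases "Q y")
    case True
    then show ?thesis using 3 by auto
  next
    case False
    then show ?thesis using 3 by (metis list.sel(1) list.set_intros(2) last_ConsR list.distinct(1) successively.simps(3))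
  qed
qed auto

context opposing_strips
begin

text \<open>Two boundary edges make \<open>J\<close> an arc of length \<open>a\<close>, and two
  boundary edges after adding \<open>z\<close> place the bar directly above or below it.\<close>

lemma row_crossing_protub:
  assumes C: "C = arc N s n" and X: "X \<subseteq> torus N" and rows: "snd ` X = insert z J" "z \<notin> J"
    and rz: "row X z = {t}" and a: "card J = a" "1 \<le> a" "a \<le> N - 2"
    and c: "n \<le> card (fst ` X)" and E: "E X \<le> barrier n"
  shows "X \<in> protub_rects N (C \<times> {1..int N}) n a 1"
proof -
  have N: "3 \<le> N" "0 < N" using N_ge n_ge by auto
  have J: "J \<subseteq> {1..int N}" "z \<in> {1..int N}" using snd_torus[OF X] rows by auto
  have fJ: "finite J" using J finite_subset by blast
  have "card (snd ` X) \<le> N - 1" "J \<noteq> {}" using rows fJ a N by auto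
  note rc = row_crossing[OF X rows this(2) rz this(1) c E]
  have "card (cyc_boundary N J) = 2" using rc(3) by simp
  then obtain y where y: "J = arc N y a"
    using cyc_boundary_2_arc[OF J(1)] a(1) by metis
  have b2: "card (cyc_boundary N (arc N y a)) = 2" "card (cyc_boundary N (insert z (arc N y a))) = 2"
    using rc(3,4) y by auto
  have aN: "a \<le> N" and zJ: "z \<notin> arc N y a" using a rows(2) y by auto
  obtain z' where z': "z' = y + int a \<or> z' = y - 1" "arc N z' 1 = {z}"
    using adjacent_to_arc[OF N(1) a(2) aN J(2) zJ b2] by metis
  have t: "arc N t 1 = {t}" using rc(2) C_sub by (intro arc_one) auto
  have "X = arc N s n \<times> arc N y a \<union> arc N t 1 \<times> arc N z' 1"
    using rc(1) C y z' t by simp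
  moreover have "arc N t 1 \<subseteq> arc N s n" using rc(2) C t by simp
  ultimately have "X \<in> bar_rects N n a 1" using z'(1) unfolding bar_rects_def by blast
  moreover have "X \<subseteq> C \<times> {1..int N}" using rc(1,2) J by auto
  ultimately show ?thesis by (simp add: protub_rects_def)
qed

text \<open>The set found has n rows and n - 1 full columns, with the extra site on a vertical side
  of length n. Membership therefore holds for the swapped set, and the height parameter is n -
  1.\<close>

lemma col_crossing_protub:
  assumes X: "X \<subseteq> torus N" and cols: "fst ` X = insert t K" "t \<notin> K"
    and ct: "col X t = {z}" and r: "n \<le> card (snd ` X)" "card (snd ` X) \<le> N - 1"
    and c: "card (fst ` X) = n" and E: "E X \<le> barrier n"
  shows "card (snd ` X) = n" "X \<in> protub_rects N (C \<times> {1..int N}) n (n - 1) 1"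
proof -
  note cc = col_crossing[OF assms]
  have N: "3 \<le> N" "0 < N" "n \<le> N" using N_ge n_ge by auto
  have R: "snd ` X \<subseteq> {1..int N}" using snd_torus[OF X] .
  have K: "K \<subseteq> {1..int N}" "t \<in> {1..int N}" using cc(3) C_sub by auto
  then have fK: "finite K" using finite_subset by blast
  have cK: "card K = n - 1" using c cols fK by simp
  have "card (cyc_boundary N (snd ` X)) = 2" "card (cyc_boundary N K) = 2" using cc(4,6) by auto
  then obtain x y where x: "snd ` X = arc N x n" and y: "K = arc N y (n - 1)"
    using cyc_boundary_2_arc[OF R] cyc_boundary_2_arc[OF K(1)] cc(1) cK by metis
  have b2: "card (cyc_boundary N (arc N y (n - 1))) = 2" "card (cyc_boundary N (insert t (arc N y (n - 1)))) = 2"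
    using cc(4,5) y by auto
  have le: "1 \<le> n - 1" "n - 1 \<le> N" and tK: "t \<notin> arc N y (n - 1)" using N n_ge cols(2) y by auto
  obtain t' where t': "t' = y + int (n - 1) \<or> t' = y - 1" "arc N t' 1 = {t}"
    using adjacent_to_arc[OF N(1) le K(2) tK b2] by metis
  have "(t, z) \<in> X" using ct by (auto simp: col_def)
  then have zR: "z \<in> snd ` X" by force
  then have z: "arc N z 1 = {z}" using R by (intro arc_one) auto
  have "prod.swap ` X = arc N x n \<times> arc N y (n - 1) \<union> arc N z 1 \<times> arc N t' 1"
    unfolding t'(2) z x[symmetric] y[symmetric]
    by (subst cc(2)) (auto simp: set_eq_iff)
  moreover have "arc N z 1 \<subseteq> arc N x n" using zR x z by simp
  ultimately have "prod.swap ` X \<in> bar_rects N n (n - 1) 1" using t'(1) unfolding bar_rects_def by blast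
  moreover have "X \<subseteq> C \<times> {1..int N}" using fst_torus[OF X] R cc(3) cols(1) by force
  ultimately show "X \<in> protub_rects N (C \<times> {1..int N}) n (n - 1) 1" by (simp add: protub_rects_def)
  show "card (snd ` X) = n" by (rule cc(1))
qed

text \<open>The endpoint is asked to meet every row, a property shared by all-plus and by every
  element of the target family of widened strips.\<close>

lemma path_meets_protub:
  assumes C: "C = arc N s n"
    and path: "successively flip_step Xs" "Xs \<noteq> []" "hd Xs = {}" "snd ` last Xs = {1..int N}"
    and bound: "\<And>X. X \<in> set Xs \<Longrightarrow> X \<subseteq> torus N" "\<And>X. X \<in> set Xs \<Longrightarrow> E X \<le> barrier n"
    and a: "n - 1 \<le> a" "a \<le> N - 2"
  shows "\<exists>X\<in>set Xs. X \<in> protub_rects N (C \<times> {1..int N}) n a 1"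
proof -
  \<comment> \<open>The alternative of N occupied rows counts it as a crossing when a narrow set
    winds around the torus. Otherwise such a set could open its n-th column with full columns, where
    the boundary bounds fail.\<close>
  define Q where "Q X \<longleftrightarrow> a + 1 \<le> card (snd ` X) \<and> (n \<le> card (fst ` X) \<or> card (snd ` X) = N)" for X :: "site set"
  have "\<not> Q (hd Xs)" "Q (last Xs)"
    using path a n_ge N_ge by (auto simp: Q_def)
  then obtain X Y where XY: "X \<in> set Xs" "Y \<in> set Xs" "flip_step X Y" "\<not> Q X" "Q Y"
    using successively_crossing[of flip_step Xs Q] path by metis
  have sub: "X \<subseteq> torus N" "Y \<subseteq> torus N" and EXY: "E X \<le> barrier n" "E Y \<le> barrier n"
    using bound XY by auto
  have fin: "finite X" "finite Y" using sub finite_subset[OF _ finite_torus] by blast+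
  have rN: "card (snd ` X) \<le> N" using card_mono[OF _ snd_torus[OF sub(1)]] by simp
  \<comment> \<open>\<open>Q\<close> persists when sites are added, so the step that makes it true
    cannot remove one.\<close>
  have "\<not> Y \<subseteq> X"
  proof
    assume "Y \<subseteq> X"
    then have "card (snd ` Y) \<le> card (snd ` X)" "card (fst ` Y) \<le> card (fst ` X)"
      using fin by (auto intro!: card_mono image_mono)
    then show False using XY rN by (auto simp: Q_def)
  qed
  then obtain t z where Y: "Y = insert (t, z) X" "(t, z) \<notin> X"
    using XY(3) unfolding flip_step_def by auto
  have snd: "snd ` Y = insert z (snd ` X)" and fst: "fst ` Y = insert t (fst ` X)" using Y by auto
  show ?thesis
  proof (cases "card (snd ` X) \<le> a")
    case True
    have z: "z \<notin> snd ` X"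
    proof
      assume "z \<in> snd ` X"
      then have "snd ` Y = snd ` X" using snd by (simp add: insert_absorb)
      then show False using True XY(5) by (simp add: Q_def)
    qed
    then have r: "card (snd ` Y) = Suc (card (snd ` X))" using snd fin by simp
    then have ra: "card (snd ` X) = a" using True XY(5) by (simp add: Q_def)
    \<comment> \<open>At most N - 1 rows are occupied after the step, which leaves only the
      alternative of at least n columns.\<close>
    have "n \<le> card (fst ` Y)" using XY(5) r ra a N_ge by (auto simp: Q_def)
    moreover have "row Y z = {t}" using z Y by (force simp: row_def)
    ultimately have "Y \<in> protub_rects N (C \<times> {1..int N}) n a 1"
      using a n_ge by (intro row_crossing_protub[OF C sub(2) snd z _ ra _ _ _ EXY(2)]) auto
    then show ?thesis using XY by blast
  next
    case False
    then have X: "card (fst ` X) \<le> n - 1" "card (snd ` X) \<noteq> N" using XY(4) by (auto simp: Q_def)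
    \<comment> \<open>A flip adds at most one row, so spanning all rows while narrow requires N - 1
      rows just before. The energy forbids this, and hence the crossing is the opening of the n-th
      column.\<close>
    have "card (snd ` X) \<noteq> N - 1" using narrow_bound[OF sub(1) _ X(1)] EXY by auto
    then have r: "card (snd ` X) \<le> N - 2" using rN X by simp
    have "card (snd ` Y) \<le> Suc (card (snd ` X))" unfolding snd by (rule card_insert_le_m1) (auto simp: fin)
    then have rY: "card (snd ` Y) \<le> N - 1" using r N_ge by simp
    then have cY: "n \<le> card (fst ` Y)" using XY(5) N_ge by (auto simp: Q_def)
    have t: "t \<notin> fst ` X"
    proof
      assume "t \<in> fst ` X"
      then have "fst ` Y = fst ` X" using fst by (simp add: insert_absorb)
      then show False using cY X n_ge by simp
    qed
    have cYn: "card (fst ` Y) = n" using cY X fst t fin n_ge by simp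
    have "col Y t = {z}" using t Y by (force simp: col_def)
    moreover have ra: "a + 1 \<le> card (snd ` Y)" using XY(5) by (simp add: Q_def)
    then have rn: "n \<le> card (snd ` Y)" using a(1) by linarith
    ultimately have cc: "card (snd ` Y) = n" "Y \<in> protub_rects N (C \<times> {1..int N}) n (n - 1) 1"
      using col_crossing_protub[OF sub(2) fst t _ _ rY cYn EXY(2)] by auto
    have "a = n - 1" using cc(1) ra a(1) by presburger
    then show ?thesis using cc XY by blast
  qed
qed

end

section \<open>A path below the barrier\<close>

definition low_step :: "nat \<Rightarrow> nat \<Rightarrow> int set \<Rightarrow> int set \<Rightarrow> site set \<Rightarrow> site set \<Rightarrow> bool" where
  "low_step N n C D X Y \<longleftrightarrow> X \<subseteq> torus N \<and> Y \<subseteq> torus N \<and> flip_step X Y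
     \<and> energy N n C D X \<le> barrier n \<and> energy N n C D Y \<le> barrier n"

lemma flip_step_sym: "flip_step X Y \<longleftrightarrow> flip_step Y X"
  unfolding flip_step_def by blast

lemma flip_step_compl:
  assumes "X \<subseteq> T" "Y \<subseteq> T" "flip_step X Y" shows "flip_step (T - X) (T - Y)"
proof -
  obtain x where "x \<notin> X \<and> Y = insert x X \<or> x \<notin> Y \<and> X = insert x Y"
    using assms by (auto simp: flip_step_def)
  then have "x \<notin> T - Y \<and> T - X = insert x (T - Y) \<or> x \<notin> T - X \<and> T - Y = insert x (T - X)"
    using assms by blast
  then show ?thesis unfolding flip_step_def by blast
qed

lemma low_step_rtranclp_sym: "(low_step N n C D)\<^sup>*\<^sup>* X Y \<Longrightarrow> (low_step N n C D)\<^sup>*\<^sup>* Y X"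
  by (rule sympD[OF symp_rtranclp]) (auto simp: symp_def low_step_def flip_step_sym)

lemma inj_on_lessThan_notin:
  fixes q :: nat
  assumes "inj_on g {..<w}" "q < w" shows "g q \<notin> g ` {..<q}"
proof
  assume "g q \<in> g ` {..<q}"
  then obtain x where x: "x < q" "g q = g x" by auto
  then show False using inj_onD[OF assms(1) x(2)] assms(2) by simp
qed

text \<open>\<open>g\<close> lists the new sites in the order in which they are filled; the partial
  fillings are the intermediate sets whose energies must be controlled.\<close>

lemma fill_sites:
  assumes "X \<subseteq> torus N" "energy N n C D X \<le> barrier n" "inj_on g {..<w}"
    and "\<And>q. q < w \<Longrightarrow> g q \<in> torus N - X"
    and "\<And>q. q < w \<Longrightarrow> energy N n C D (X \<union> g ` {..<Suc q}) \<le> barrier n"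
  shows "(low_step N n C D)\<^sup>*\<^sup>* X (X \<union> g ` {..<w})"
  using assms
proof (induction w)
  case (Suc w)
  have "(low_step N n C D)\<^sup>*\<^sup>* X (X \<union> g ` {..<w})"
    using Suc.prems by (intro Suc.IH) (auto simp: lessThan_Suc)
  moreover have "low_step N n C D (X \<union> g ` {..<w}) (X \<union> g ` {..<Suc w})"
  proof -
    have "energy N n C D (X \<union> g ` {..<w}) \<le> barrier n"
      using Suc.prems(2) Suc.prems(5)[of "w - 1"] by (cases w) auto
    moreover have "g w \<notin> X \<union> g ` {..<w}"
      using inj_on_lessThan_notin[OF Suc.prems(3), of w] Suc.prems(4)[of w] by simp
    then have "flip_step (X \<union> g ` {..<w}) (X \<union> g ` {..<Suc w})"
      unfolding flip_step_def by (intro exI[of _ "g w"] disjI1) (auto simp: lessThan_Suc)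
    ultimately show ?thesis using Suc.prems by (auto simp: low_step_def less_Suc_eq)
  qed
  ultimately show ?case by (rule rtranclp.rtrancl_into_rtrancl)
qed auto

lemma energy_insert_le:
  assumes "3 \<le> N" "(i, j) \<in> torus N" "(i, j) \<notin> X" "X \<subseteq> torus N"
    and "p \<le> of_bool ((cprev N i, j) \<in> X) + of_bool ((cnext N i, j) \<in> X)
      + of_bool ((i, cprev N j) \<in> X) + of_bool ((i, cnext N j) \<in> X)"
  shows "energy N n C D (insert (i, j) X) \<le> energy N n C D X + int n * (4 - 2 * p)
    - 2 * of_bool (i \<in> C) + 2 * of_bool (i \<in> D)"
  unfolding energy_insert[OF assms(1-4)] using assms(5)
  by (intro add_mono diff_mono mult_left_mono) auto

lemma offset_add: "offset N (s + int k) d = offset N s (k + d)"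
  by (simp add: offset_def algebra_simps)

lemma arc_shift:
  assumes "w \<le> N" shows "arc N (s + int u) w = offset N s ` {u..<u + w}"
proof -
  have "arc N (s + int u) w = offset N s ` ((+) u ` {..<w})"
    using assms by (simp add: arc_eq_offset offset_add image_image)
  also have "(+) u ` {..<w} = {u..<u + w}" by (simp add: lessThan_atLeast0 add.commute)
  finally show ?thesis .
qed

lemma arc_zero: "arc N s 0 = {}"
  by (simp add: arc_eq_offset)

lemma cprev_offset: "0 < N \<Longrightarrow> cprev N (offset N s (Suc d)) = offset N s d"
  using cnext_offset[of N s d] cprev_cnext[OF offset_in] by metis

section \<open>Filling A by rows and the neutral strips by columns\<close>

context opposing_strips
begin

lemma barrier_ge: "2 * int n \<le> barrier n" "0 \<le> barrier n"
proof -
  have "3 * 3 \<le> int n * int n" using n_ge by (intro mult_mono) auto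
  then show "2 * int n \<le> barrier n" "0 \<le> barrier n" by (auto simp: barrier_def)
qed

text \<open>\<open>p\<close> counts the vertical neighbours present beforehand: 0 in the first row,
  1 in a middle row, 2 in the row that closes the strip. The first site meets only these, each later
  site also its predecessor in the row, which gives the two rates n(4 - 2p) and n(2 - 2p).\<close>

lemma fill_row:
  assumes C: "C = arc N s n" and r: "r < N"
    and p: "p = of_bool (1 \<le> r) + of_bool (1 \<le> r \<and> r = N - 1)"
    and g: "g = (\<lambda>q. (offset N s q, int r + 1))" and X: "X = C \<times> {1..int r}"
  shows "q \<le> n \<Longrightarrow> 1 \<le> q \<Longrightarrow> E (X \<union> g ` {..<q}) \<le>
    E X + int n * (4 - 2 * p) + (int q - 1) * (int n * (2 - 2 * p)) - 2 * int q"
    and "inj_on g {..<n}" and "q < n \<Longrightarrow> g q \<in> torus N - X" and "X \<subseteq> torus N"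
    and "X \<union> g ` {..<n} = C \<times> {1..int (Suc r)}"
proof -
  have N: "3 \<le> N" "0 < N" "n \<le> N" using N_ge n_ge by auto
  have inj: "inj_on (offset N s) {..<n}" by (rule inj_on_subset[OF offset_inj]) (use N in auto)
  then show injg: "inj_on g {..<n}" unfolding g by (auto simp: inj_on_def)
  have CO: "C = offset N s ` {..<n}" unfolding C using N by (simp add: arc_eq_offset)
  show g_in: "g q \<in> torus N - X" if "q < n" for q
    using that r offset_in[OF N(2)] unfolding g X by (auto simp: torus_def)
  show X_sub: "X \<subseteq> torus N" unfolding X using C_sub r by (auto simp: torus_def)
  show "X \<union> g ` {..<n} = C \<times> {1..int (Suc r)}"
  proof -
    have "{1..int (Suc r)} = insert (int r + 1) {1..int r}" by auto
    moreover have "g ` {..<n} = C \<times> {int r + 1}" unfolding g CO by auto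
    ultimately show ?thesis unfolding X by auto
  qed
  have step: "E (X \<union> g ` {..<Suc q}) \<le> E (X \<union> g ` {..<q}) + int n * (4 - 2 * (p + of_bool (1 \<le> q))) - 2"
    if q: "q < n" for q
  proof -
    define Y where "Y = X \<union> g ` {..<q}"
    let ?i = "offset N s q" and ?j = "int r + 1"
    have i: "?i \<in> C" "?i \<notin> D" using q CO CD by auto
    have "g q \<notin> g ` {..<q}" using inj_on_lessThan_notin[OF injg q] .
    then have "(?i, ?j) \<notin> Y" using g_in[OF q] unfolding g Y_def by auto
    moreover have "(?i, ?j) \<in> torus N" using g_in[OF q] unfolding g by auto
    moreover have "Y \<subseteq> torus N" using X_sub g_in q by (auto simp: Y_def)
    moreover have "(cprev N ?i, ?j) \<in> Y" if "1 \<le> q"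
    proof -
      have "cprev N ?i = offset N s (q - 1)" using cprev_offset[OF N(2), of s "q - 1"] that by simp
      then have "(cprev N ?i, ?j) = g (q - 1)" unfolding g by simp
      then show ?thesis using that by (auto simp: Y_def)
    qed
    moreover have "(?i, cprev N ?j) \<in> Y" if "1 \<le> r"
      using that i by (auto simp: X Y_def cprev_def)
    moreover have "(?i, cnext N ?j) \<in> Y" if "1 \<le> r" "r = N - 1"
      using that i by (auto simp: X Y_def cnext_def of_nat_diff)
    ultimately have "E (insert (?i, ?j) Y) \<le> E Y + int n * (4 - 2 * (p + of_bool (1 \<le> q)))
        - 2 * of_bool (?i \<in> C) + 2 * of_bool (?i \<in> D)"
      by (intro energy_insert_le[OF N(1)]) (auto simp: p)
    moreover have "insert (?i, ?j) Y = X \<union> g ` {..<Suc q}" unfolding g Y_def by (auto simp: lessThan_Suc)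
    ultimately show ?thesis using i by (simp add: Y_def)
  qed
  show "E (X \<union> g ` {..<q}) \<le> E X + int n * (4 - 2 * p) + (int q - 1) * (int n * (2 - 2 * p)) - 2 * int q"
    if "q \<le> n" "1 \<le> q"
    using that(2,1)
  proof (induction q rule: nat_induct_at_least)
    case base
    then show ?case using step[of 0] by simp
  next
    case (Suc q)
    then show ?case using step[of q] by (simp add: algebra_simps)
  qed
qed

text \<open>The first row climbs to 2n^2. Every later row starts with a rise of 2n - 2, which may
  touch the barrier, and then loses 2 with each of its remaining n - 1 sites, returning to its
  starting level.\<close>

lemma empty_to_rows:
  assumes C: "C = arc N s n" and r: "1 \<le> r" "r < N"
  shows "(low_step N n C D)\<^sup>*\<^sup>* {} (C \<times> {1..int r}) \<and> E (C \<times> {1..int r}) \<le> 2 * int n * int n"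
  using r
proof (induction r rule: nat_induct_at_least)
  case base
  define g where "g = (\<lambda>q. (offset N s q, int 0 + 1))"
  note fr = fill_row[OF C, of 0 0 g "{}"]
  have 0: "energy N n C D {} = 0" by (simp add: energy_def perimeter_def row_def col_def)
  have N: "0 < N" using base by simp
  have e: "E ({} \<union> g ` {..<q}) \<le> 2 * int n + 2 * (int n - 1) * int q" if "1 \<le> q" "q \<le> n" for q
    using fr(1)[OF N _ _ _ that(2,1)] by (simp add: 0 g_def algebra_simps)
  have e': "E ({} \<union> g ` {..<q}) \<le> 2 * int n * int n" if "1 \<le> q" "q \<le> n" for q
  proof -
    have "2 * (int n - 1) * int q \<le> 2 * (int n - 1) * int n" using that by (intro mult_left_mono) auto
    then show ?thesis using e[OF that] by (simp add: algebra_simps)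
  qed
  have "(low_step N n C D)\<^sup>*\<^sup>* {} ({} \<union> g ` {..<n})"
  proof (rule fill_sites)
    show "inj_on g {..<n}" using fr(2)[OF N] by (simp add: g_def)
    show "g q \<in> torus N - {}" if "q < n" for q using fr(3)[OF N _ _ _ that] by (simp add: g_def)
    show "E ({} \<union> g ` {..<Suc q}) \<le> barrier n" if "q < n" for q
      using e'[of "Suc q"] that n_ge by (simp add: barrier_def)
  qed (use barrier_ge 0 in auto)
  moreover have "{} \<union> g ` {..<n} = C \<times> {1..int 1}" using fr(5)[OF N] by (simp add: g_def)
  ultimately show ?case using e'[of n] n_ge by simp
next
  case (Suc r)
  let ?X = "C \<times> {1..int r}"
  define g where "g = (\<lambda>q. (offset N s q, int r + 1))"
  note fr = fill_row[OF C _ _ g_def refl, of 1]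
  have r: "r < N" "(1 :: int) = of_bool (1 \<le> r) + of_bool (1 \<le> r \<and> r = N - 1)" using Suc by auto
  have IH: "(low_step N n C D)\<^sup>*\<^sup>* {} ?X" "E ?X \<le> 2 * int n * int n" using Suc by auto
  have e: "E (?X \<union> g ` {..<q}) \<le> E ?X + 2 * int n - 2 * int q" if "1 \<le> q" "q \<le> n" for q
    using fr(1)[OF r that(2,1)] by simp
  have "(low_step N n C D)\<^sup>*\<^sup>* ?X (?X \<union> g ` {..<n})"
  proof (rule fill_sites)
    show "inj_on g {..<n}" using fr(2)[OF r] .
    show "g q \<in> torus N - ?X" if "q < n" for q using fr(3)[OF r that] .
    show "E (?X \<union> g ` {..<Suc q}) \<le> barrier n" if "q < n" for q
      using e[of "Suc q"] that IH by (simp add: barrier_def)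
  qed (use n_ge IH fr(4)[OF r] in \<open>auto simp: barrier_def\<close>)
  then have "(low_step N n C D)\<^sup>*\<^sup>* {} (?X \<union> g ` {..<n})" using IH by simp
  moreover have "E (?X \<union> g ` {..<n}) \<le> 2 * int n * int n" using e[of n] IH n_ge by simp
  ultimately show ?case unfolding fr(5)[OF r] by blast
qed

text \<open>The last row touches both row N - 1 and row 1. Its first site changes the energy by at
  most -2 and each later one by at most -2n - 2, a total drop of 2n^2.\<close>

lemma empty_to_strip:
  assumes C: "C = arc N s n"
  shows "(low_step N n C D)\<^sup>*\<^sup>* {} (C \<times> {1..int N})" "E (C \<times> {1..int N}) \<le> 0"
proof -
  let ?r = "N - 1"
  let ?X = "C \<times> {1..int ?r}"
  define g where "g = (\<lambda>q. (offset N s q, int ?r + 1))"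
  note fr = fill_row[OF C _ _ g_def refl, of 2]
  have r: "?r < N" "(2 :: int) = of_bool (1 \<le> ?r) + of_bool (1 \<le> ?r \<and> ?r = N - 1)" using N_ge n_ge by auto
  have IH: "(low_step N n C D)\<^sup>*\<^sup>* {} ?X" "E ?X \<le> 2 * int n * int n"
    using empty_to_rows[OF C, of ?r] N_ge n_ge by auto
  have e: "E (?X \<union> g ` {..<q}) \<le> E ?X - (int q - 1) * (2 * int n) - 2 * int q" if "1 \<le> q" "q \<le> n" for q
    using fr(1)[OF r that(2,1)] by (simp add: algebra_simps)
  have "(low_step N n C D)\<^sup>*\<^sup>* ?X (?X \<union> g ` {..<n})"
  proof (rule fill_sites)
    show "inj_on g {..<n}" using fr(2)[OF r] .
    show "g q \<in> torus N - ?X" if "q < n" for q using fr(3)[OF r that] .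
    show "E (?X \<union> g ` {..<Suc q}) \<le> barrier n" if "q < n" for q
    proof -
      have "0 \<le> int q * (2 * int n)" by simp
      moreover have "E (?X \<union> g ` {..<Suc q}) \<le> E ?X - int q * (2 * int n) - 2 * int (Suc q)"
        using e[of "Suc q"] that by simp
      ultimately show ?thesis using IH(2) n_ge unfolding barrier_def by linarith
    qed
  qed (use n_ge IH fr(4)[OF r] in \<open>auto simp: barrier_def\<close>)
  moreover have fin: "?X \<union> g ` {..<n} = C \<times> {1..int N}" using fr(5)[OF r] N_ge by simp
  ultimately show "(low_step N n C D)\<^sup>*\<^sup>* {} (C \<times> {1..int N})" using IH by simp
  show "E (C \<times> {1..int N}) \<le> 0"
    unfolding fin[symmetric] using e[of n] IH n_ge by (simp add: algebra_simps)
qed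

text \<open>Next to a full column the first site of a neutral column costs at most 2n, the following
  ones nothing, and the site closing the column returns 2n. Ending at energy at most 0 allows
  iteration.\<close>

lemma fill_column:
  assumes U: "U \<subseteq> {1..int N}" and i: "i \<in> {1..int N}" "i \<notin> U" "i \<notin> C" "i \<notin> D"
    and adj: "cprev N i \<in> U \<or> cnext N i \<in> U" and E: "E (U \<times> {1..int N}) \<le> 0"
  shows "(low_step N n C D)\<^sup>*\<^sup>* (U \<times> {1..int N}) (insert i U \<times> {1..int N})"
    "E (insert i U \<times> {1..int N}) \<le> 0"
proof -
  have N: "3 \<le> N" "0 < N" using N_ge n_ge by auto
  let ?X = "U \<times> {1..int N}"
  define g where "g = (\<lambda>q. (i, int q + 1))"
  have X: "?X \<subseteq> torus N" using U by (auto simp: torus_def)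
  have g_in: "g q \<in> torus N - ?X" if "q < N" for q using that i by (auto simp: g_def torus_def)
  have step: "E (?X \<union> g ` {..<Suc q}) \<le> E (?X \<union> g ` {..<q}) + int n * (4 - 2 * (1 + of_bool (1 \<le> q) + of_bool (q = N - 1)))"
    if q: "q < N" for q
  proof -
    define Y where "Y = ?X \<union> g ` {..<q}"
    let ?j = "int q + 1"
    have "(i, ?j) \<notin> Y" using i by (auto simp: g_def Y_def)
    moreover have "(i, ?j) \<in> torus N" using q i by (auto simp: torus_def)
    moreover have "Y \<subseteq> torus N" using X g_in q by (auto simp: Y_def)
    moreover have "(cprev N i, ?j) \<in> Y \<or> (cnext N i, ?j) \<in> Y" using adj q by (auto simp: Y_def)
    moreover have "(i, cprev N ?j) \<in> Y" if "1 \<le> q"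
    proof -
      have "(i, cprev N ?j) = g (q - 1)" using that by (simp add: g_def cprev_def of_nat_diff)
      then show ?thesis using that by (auto simp: Y_def)
    qed
    moreover have "(i, cnext N ?j) \<in> Y" if "q = N - 1"
    proof -
      have "(i, cnext N ?j) = g 0" using that N by (simp add: g_def cnext_def of_nat_diff)
      then show ?thesis using that N by (auto simp: Y_def)
    qed
    ultimately have "E (insert (i, ?j) Y) \<le> E Y + int n * (4 - 2 * (1 + of_bool (1 \<le> q) + of_bool (q = N - 1)))
        - 2 * of_bool (i \<in> C) + 2 * of_bool (i \<in> D)"
      using N by (intro energy_insert_le[OF N(1)]) (auto simp del: One_nat_def)
    moreover have "insert (i, ?j) Y = ?X \<union> g ` {..<Suc q}" unfolding g_def Y_def by (auto simp: lessThan_Suc)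
    ultimately show ?thesis using i by (simp add: Y_def)
  qed
  have mid: "E (?X \<union> g ` {..<q}) \<le> 2 * int n" if "1 \<le> q" "q < N" for q
    using that
  proof (induction q rule: nat_induct_at_least)
    case base
    then show ?case using step[of 0] E by simp
  next
    case (Suc q)
    have "q \<noteq> N - 1" using Suc.prems by linarith
    then show ?case using Suc step[of q] by simp
  qed
  have last: "E (?X \<union> g ` {..<N}) \<le> 0"
  proof -
    have "1 \<le> N - 1" "N - 1 < N" using N by auto
    then show ?thesis using step[of "N - 1"] mid[of "N - 1"] by simp
  qed
  have eq: "?X \<union> g ` {..<N} = insert i U \<times> {1..int N}"
  proof -
    have "g ` {..<N} = {i} \<times> {1..int N}"
    proof (intro equalityI subsetI)
      fix x assume "x \<in> {i} \<times> {1..int N}"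
      then obtain j where "x = (i, j)" "1 \<le> j" "j \<le> int N" by auto
      then have "x = g (nat (j - 1))" "nat (j - 1) < N" by (auto simp: g_def)
      then show "x \<in> g ` {..<N}" by blast
    qed (auto simp: g_def)
    then show ?thesis by auto
  qed
  have "(low_step N n C D)\<^sup>*\<^sup>* ?X (?X \<union> g ` {..<N})"
  proof (rule fill_sites)
    show "inj_on g {..<N}" by (auto simp: g_def inj_on_def)
    show "g q \<in> torus N - ?X" if "q < N" for q using g_in[OF that] .
    show "E (?X \<union> g ` {..<Suc q}) \<le> barrier n" if "q < N" for q
      using mid[of "Suc q"] last barrier_ge that by (cases "Suc q = N") auto
    show "E ?X \<le> barrier n" using E barrier_ge by simp
  qed (rule X)
  then show "(low_step N n C D)\<^sup>*\<^sup>* ?X (insert i U \<times> {1..int N})" unfolding eq .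
  show "E (insert i U \<times> {1..int N}) \<le> 0" using last unfolding eq .
qed

text \<open>Columns are numbered from the first column of the neutral strip preceding A: k neutral,
  n of A, k neutral, then B. All sets of columns involved are then intervals of parameters without
  wraparound.\<close>

lemma strip_to_neutral:
  assumes f: "f = offset N s" and C: "C = f ` {k..<k + n}" and D: "D = f ` {n + 2 * k..<N}"
    and N: "n + 2 * k \<le> N" and E: "E (C \<times> {1..int N}) \<le> 0"
  shows "(low_step N n C D)\<^sup>*\<^sup>* (C \<times> {1..int N}) (f ` {..<n + 2 * k} \<times> {1..int N})"
proof -
  let ?S = "\<lambda>u v. f ` {u..<v} \<times> {1..int N}"
  have N0: "0 < N" using N_ge by simp
  have inj: "f d = f e \<longleftrightarrow> d = e" if "d < N" "e < N" for d e
    using that unfolding f by (simp add: offset_eq_iff)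
  have sub: "f ` M \<subseteq> {1..int N}" for M unfolding f using offset_in[OF N0] by auto
  have notin: "f d \<notin> f ` {u..<v}" if "d < N" "v \<le> N" "d < u \<or> v \<le> d" for d u v
    using that inj by force
  \<comment> \<open>The neutral columns after A are added in increasing order, and later those
    before A in decreasing order, so each new column touches the current strip.\<close>
  have right: "(low_step N n C D)\<^sup>*\<^sup>* (C \<times> {1..int N}) (?S k (k + n + l)) \<and> E (?S k (k + n + l)) \<le> 0"
    if "l \<le> k" for l
    using that
  proof (induction l)
    case 0
    then show ?case using C E by simp
  next
    case (Suc l)
    let ?v = "k + n + l"
    have v: "?v < N" "{k..<k + n + Suc l} = insert ?v {k..<?v}" using Suc.prems N by auto
    have "cprev N (f ?v) = f (?v - 1)" using cprev_offset[OF N0, of s "?v - 1"] n_ge unfolding f by simp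
    then have adj: "cprev N (f ?v) \<in> f ` {k..<?v} \<or> cnext N (f ?v) \<in> f ` {k..<?v}" using n_ge by auto
    have nC: "f ?v \<notin> f ` {k..<?v}" "f ?v \<notin> C" "f ?v \<notin> D"
      unfolding C D using v Suc.prems N
      by (intro notin; simp)+
    have "f ?v \<in> {1..int N}" using sub[of "{?v}"] by simp
    moreover have IH: "(low_step N n C D)\<^sup>*\<^sup>* (C \<times> {1..int N}) (?S k ?v)" "E (?S k ?v) \<le> 0" using Suc by auto
    ultimately have "(low_step N n C D)\<^sup>*\<^sup>* (?S k ?v) (?S k (k + n + Suc l)) \<and> E (?S k (k + n + Suc l)) \<le> 0"
      using fill_column[OF sub _ nC adj IH(2)] unfolding v(2) image_insert by blast
    then show ?case using rtranclp_trans[OF IH(1)] by blast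
  qed
  have "(low_step N n C D)\<^sup>*\<^sup>* (C \<times> {1..int N}) (?S (k - l) (n + 2 * k)) \<and> E (?S (k - l) (n + 2 * k)) \<le> 0"
    if "l \<le> k" for l
    using that
  proof (induction l)
    case 0
    have "k + n + k = n + 2 * k" by simp
    then show ?case using right[OF order_refl] by (simp only: diff_zero)
  next
    case (Suc l)
    let ?u = "k - Suc l" and ?V = "{k - l..<n + 2 * k}"
    have u: "?u < N" "?u < k - l" "{?u..<n + 2 * k} = insert ?u ?V" using Suc.prems N N0 by auto
    have "cnext N (f ?u) = f (k - l)" using cnext_offset[OF N0, of s ?u] Suc.prems unfolding f by (simp add: Suc_diff_Suc)
    then have adj: "cprev N (f ?u) \<in> f ` ?V \<or> cnext N (f ?u) \<in> f ` ?V" using n_ge by auto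
    have nC: "f ?u \<notin> f ` ?V" "f ?u \<notin> C" "f ?u \<notin> D"
      unfolding C D using u Suc.prems N
      by (intro notin; simp)+
    have "f ?u \<in> {1..int N}" using sub[of "{?u}"] by simp
    moreover have IH: "(low_step N n C D)\<^sup>*\<^sup>* (C \<times> {1..int N}) (f ` ?V \<times> {1..int N})" "E (f ` ?V \<times> {1..int N}) \<le> 0"
      using Suc by auto
    ultimately have "(low_step N n C D)\<^sup>*\<^sup>* (f ` ?V \<times> {1..int N}) (?S ?u (n + 2 * k)) \<and> E (?S ?u (n + 2 * k)) \<le> 0"
      using fill_column[OF sub _ nC adj IH(2)] unfolding u(3) image_insert by blast
    then show ?case using rtranclp_trans[OF IH(1)] by blast
  qed
  from this[of k] show ?thesis by (simp add: atLeast0LessThan)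
qed

end

section \<open>Optimal paths\<close>

definition plus_sites :: "nat \<Rightarrow> conf \<Rightarrow> site set" where
  "plus_sites N \<sigma> = {x \<in> torus N. \<sigma> x = 1}"

lemma plus_sites_subset: "plus_sites N \<sigma> \<subseteq> torus N"
  by (auto simp: plus_sites_def)

lemma configs_value: "\<sigma> \<in> configs N \<Longrightarrow> x \<in> torus N \<Longrightarrow> \<sigma> x = 1 \<or> \<sigma> x = -1"
  by (auto simp: configs_def dest: PiE_mem)

lemma flip_step_plus_sites:
  assumes "\<sigma> \<in> configs N" "\<tau> \<in> configs N" "card {x \<in> torus N. \<sigma> x \<noteq> \<tau> x} = 1"
  shows "flip_step (plus_sites N \<sigma>) (plus_sites N \<tau>)"
proof -
  obtain x where "{x \<in> torus N. \<sigma> x \<noteq> \<tau> x} = {x}" using assms(3) by (auto simp: card_1_singleton_iff)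
  then have x: "x \<in> torus N" "\<sigma> x \<noteq> \<tau> x" and eq: "\<And>y. y \<in> torus N \<Longrightarrow> y \<noteq> x \<Longrightarrow> \<sigma> y = \<tau> y" by auto
  consider "\<sigma> x = -1" "\<tau> x = 1" | "\<sigma> x = 1" "\<tau> x = -1"
    using configs_value[OF assms(1) x(1)] configs_value[OF assms(2) x(1)] x(2) by auto
  then show ?thesis
  proof cases
    case 1
    then have "x \<notin> plus_sites N \<sigma>" "plus_sites N \<tau> = insert x (plus_sites N \<sigma>)"
      using eq x(1) by (auto simp: plus_sites_def) (metis x(1))+
    then show ?thesis unfolding flip_step_def by blast
  next
    case 2
    then have "x \<notin> plus_sites N \<tau>" "plus_sites N \<sigma> = insert x (plus_sites N \<tau>)"
      using eq x(1) by (auto simp: plus_sites_def) (metis x(1))+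
    then show ?thesis unfolding flip_step_def by blast
  qed
qed

lemma path_plus_sites:
  assumes "is_path N \<omega>" shows "successively flip_step (map (plus_sites N) \<omega>)"
proof -
  have sub: "set \<omega> \<subseteq> configs N"
    and "successively (\<lambda>\<sigma> \<tau>. card {x \<in> torus N. \<sigma> x \<noteq> \<tau> x} = 1) \<omega>"
    using assms by (auto simp: is_path_def)
  from this(2) show ?thesis unfolding successively_map
  proof (rule successively_mono)
    fix \<sigma> \<tau> assume "\<sigma> \<in> set \<omega>" "\<tau> \<in> set \<omega>" "card {x \<in> torus N. \<sigma> x \<noteq> \<tau> x} = 1"
    then show "flip_step (plus_sites N \<sigma>) (plus_sites N \<tau>)" using sub by (intro flip_step_plus_sites) blast+
  qed
qed

lemma card_conf_of_flip:
  assumes "X \<subseteq> torus N" "Y \<subseteq> torus N" "flip_step X Y"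
  shows "card {x \<in> torus N. conf_of N X x \<noteq> conf_of N Y x} = 1"
proof -
  obtain x where x: "x \<notin> X \<and> Y = insert x X \<or> x \<notin> Y \<and> X = insert x Y"
    using assms(3) by (auto simp: flip_step_def)
  then have "{x \<in> torus N. conf_of N X x \<noteq> conf_of N Y x} = {x}"
    using assms(1,2) by (auto simp: conf_of_def)
  then show ?thesis by simp
qed

lemma low_steps_path:
  assumes "(low_step N n C D)\<^sup>*\<^sup>* X Y" "X \<subseteq> torus N" "energy N n C D X \<le> barrier n"
  shows "\<exists>\<omega>. is_path N \<omega> \<and> hd \<omega> = conf_of N X \<and> last \<omega> = conf_of N Y \<and>
    (\<forall>\<zeta>\<in>set \<omega>. \<exists>Z. Z \<subseteq> torus N \<and> \<zeta> = conf_of N Z \<and> energy N n C D Z \<le> barrier n)"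
  using assms
proof (induction rule: rtranclp_induct)
  case base
  then show ?case by (intro exI[of _ "[conf_of N X]"]) (auto simp: is_path_def conf_of_in_configs)
next
  case (step Y Z)
  then obtain \<omega> where w: "is_path N \<omega>" "hd \<omega> = conf_of N X" "last \<omega> = conf_of N Y"
    "\<forall>\<zeta>\<in>set \<omega>. \<exists>Z. Z \<subseteq> torus N \<and> \<zeta> = conf_of N Z \<and> energy N n C D Z \<le> barrier n" by blast
  have st: "Y \<subseteq> torus N" "Z \<subseteq> torus N" "flip_step Y Z" "energy N n C D Z \<le> barrier n"
    using step by (auto simp: low_step_def)
  have "is_path N (\<omega> @ [conf_of N Z])"
    using w card_conf_of_flip[OF st(1-3)]
    by (auto simp: is_path_def successively_append_iff conf_of_in_configs)
  moreover have "hd (\<omega> @ [conf_of N Z]) = conf_of N X" using w by (auto simp: is_path_def)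
  ultimately show ?case using w st by (intro exI[of _ "\<omega> @ [conf_of N Z]"]) auto
qed

text \<open>All path heights are values of \<open>H\<close> on the finite set of configurations, so
  the minimum is over a finite set and any competitor bounds it from above.\<close>

lemma opt_path_height_le:
  assumes "\<omega> \<in> opt_paths N H \<eta> W" "\<omega>' \<in> paths N \<eta> W" "\<And>\<zeta>. \<zeta> \<in> set \<omega>' \<Longrightarrow> H \<zeta> \<le> h" "\<zeta> \<in> set \<omega>"
  shows "H \<zeta> \<le> h"
proof -
  have "path_height H ` paths N \<eta> W \<subseteq> H ` configs N"
  proof safe
    fix \<omega> assume "\<omega> \<in> paths N \<eta> W"
    then have "\<omega> \<noteq> []" "set \<omega> \<subseteq> configs N" by (auto simp: paths_def is_path_def)
    then have "path_height H \<omega> \<in> H ` set \<omega>" unfolding path_height_def by (intro Max_in) auto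
    then show "path_height H \<omega> \<in> H ` configs N" using \<open>set \<omega> \<subseteq> configs N\<close> by blast
  qed
  moreover have "finite (configs N)" unfolding configs_def by (intro finite_PiE) auto
  ultimately have "finite (path_height H ` paths N \<eta> W)" using finite_subset by blast
  then have "comm_height N H \<eta> W \<le> path_height H \<omega>'"
    unfolding comm_height_def using assms(2) by (intro Min_le) auto
  moreover have "path_height H \<omega>' \<le> h"
    unfolding path_height_def using assms(2,3) by (intro Max.boundedI) (auto simp: paths_def is_path_def)
  moreover have "H \<zeta> \<le> path_height H \<omega>" unfolding path_height_def using assms(4) by (intro Max_ge) auto
  moreover have "path_height H \<omega> = comm_height N H \<eta> W" using assms(1) by (simp add: opt_paths_def)
  ultimately show ?thesis by simp
qed

context opposing_strips
begin

lemma opt_path_energy_le: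
  assumes H: "H = hamiltonian N (C \<times> {1..int N}) (D \<times> {1..int N}) (real n)"
    and opt: "\<omega> \<in> opt_paths N H (all_minus N) W"
    and Y: "(low_step N n C D)\<^sup>*\<^sup>* {} Y" "conf_of N Y \<in> W" and \<zeta>: "\<zeta> \<in> set \<omega>"
  shows "E (plus_sites N \<zeta>) \<le> barrier n"
proof -
  have N: "3 \<le> N" using N_ge n_ge by simp
  note Ham = hamiltonian_conf_of[OF N C_sub D_sub, of _ n, folded H]
  have "energy N n C D {} = 0" by (simp add: energy_def perimeter_def row_def col_def)
  then obtain \<omega>' where w: "is_path N \<omega>'" "hd \<omega>' = conf_of N {}" "last \<omega>' = conf_of N Y"
    "\<forall>\<zeta>\<in>set \<omega>'. \<exists>Z. Z \<subseteq> torus N \<and> \<zeta> = conf_of N Z \<and> energy N n C D Z \<le> barrier n"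
    using low_steps_path[OF Y(1)] barrier_ge by auto
  have p: "\<omega>' \<in> paths N (all_minus N) W" using w Y by (simp add: paths_def all_minus_conf_of)
  have "H \<xi> \<le> H (all_minus N) + of_int (barrier n)" if \<xi>: "\<xi> \<in> set \<omega>'" for \<xi>
  proof -
    obtain Z where "Z \<subseteq> torus N" "\<xi> = conf_of N Z" "energy N n C D Z \<le> barrier n" using w(4) \<xi> by blast
    then show ?thesis by (simp add: Ham)
  qed
  then have "H \<zeta> \<le> H (all_minus N) + of_int (barrier n)"
    by (rule opt_path_height_le[OF opt p _ \<zeta>])
  moreover have "\<zeta> \<in> configs N" using opt \<zeta> by (auto simp: opt_paths_def paths_def is_path_def)
  then have "H \<zeta> = H (all_minus N) + of_int (E (plus_sites N \<zeta>))"
    using Ham[OF plus_sites_subset] conf_of_plus_sites unfolding plus_sites_def by metis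
  ultimately show ?thesis by simp
qed

lemma path_meets_Sigma_plus:
  assumes C: "C = arc N s n" and path: "\<omega> \<in> paths N (all_minus N) W"
    and last: "snd ` plus_sites N (last \<omega>) = {1..int N}"
    and low: "\<And>\<zeta>. \<zeta> \<in> set \<omega> \<Longrightarrow> E (plus_sites N \<zeta>) \<le> barrier n"
    and a: "n - 1 \<le> a" "a \<le> N - 2"
  shows "set \<omega> \<inter> Sigma_plus N (protub_rects N (C \<times> {1..int N}) n a 1) \<noteq> {}"
proof -
  have w: "is_path N \<omega>" "\<omega> \<noteq> []" "set \<omega> \<subseteq> configs N" "hd \<omega> = all_minus N"
    using path by (auto simp: paths_def is_path_def)
  have "plus_sites N (all_minus N) = {}" by (auto simp: plus_sites_def all_minus_def)
  moreover have "X \<subseteq> torus N" "E X \<le> barrier n" if X: "X \<in> set (map (plus_sites N) \<omega>)" for X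
  proof -
    obtain \<zeta> where "X = plus_sites N \<zeta>" "\<zeta> \<in> set \<omega>" using X unfolding set_map by (rule imageE)
    then show "X \<subseteq> torus N" "E X \<le> barrier n" using low plus_sites_subset by simp_all
  qed
  ultimately have "\<exists>X\<in>set (map (plus_sites N) \<omega>). X \<in> protub_rects N (C \<times> {1..int N}) n a 1"
    using w(2,4) last path_plus_sites[OF w(1)]
    by (intro path_meets_protub[OF C _ _ _ _ _ _ a]) (simp_all add: hd_map last_map)
  then obtain \<zeta> where z: "\<zeta> \<in> set \<omega>" "plus_sites N \<zeta> \<in> protub_rects N (C \<times> {1..int N}) n a 1" by auto
  then have "\<zeta> = conf_of N (plus_sites N \<zeta>)" using conf_of_plus_sites w(3) by (auto simp: plus_sites_def)
  then show ?thesis using z unfolding Sigma_plus_def by blast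
qed

text \<open>The complements read backwards form a path from the empty set to the full torus with the
  two fields exchanged. The rectangle it must meet in B consists of minus sites of the original
  path.\<close>

lemma path_meets_Sigma_minus:
  assumes D: "D = arc N s n" and path: "\<omega> \<in> paths N (all_minus N) {all_plus N}"
    and low: "\<And>\<zeta>. \<zeta> \<in> set \<omega> \<Longrightarrow> E (plus_sites N \<zeta>) \<le> barrier n"
    and a: "n - 1 \<le> a" "a \<le> N - 2"
  shows "set \<omega> \<inter> Sigma_minus N (protub_rects N (D \<times> {1..int N}) n a 1) \<noteq> {}"
proof -
  have w: "is_path N \<omega>" "\<omega> \<noteq> []" "set \<omega> \<subseteq> configs N" "hd \<omega> = all_minus N" "last \<omega> = all_plus N"
    using path by (auto simp: paths_def is_path_def)
  have cD: "card D = n" unfolding D using N_ge by (intro card_arc) simp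
  interpret opp: opposing_strips N n D C
    using N_ge n_ge C_sub D_sub CD card_C cD by unfold_locales auto
  let ?m = "\<lambda>\<zeta>. torus N - plus_sites N \<zeta>"
  have N: "0 < N" using N_ge by simp
  have "successively (\<lambda>\<sigma> \<tau>. flip_step (plus_sites N \<sigma>) (plus_sites N \<tau>)) \<omega>"
    using path_plus_sites[OF w(1)] by (simp add: successively_map)
  then have "successively (\<lambda>\<sigma> \<tau>. flip_step (?m \<tau>) (?m \<sigma>)) \<omega>"
    by (rule successively_mono)
      (metis flip_step_compl[OF plus_sites_subset plus_sites_subset] flip_step_sym)
  then have "successively flip_step (rev (map ?m \<omega>))"
    by (simp add: successively_rev successively_map)
  moreover have "hd (rev (map ?m \<omega>)) = {}"
    using w by (auto simp: hd_rev last_map plus_sites_def all_plus_def)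
  moreover have "last (rev (map ?m \<omega>)) = torus N"
    using w by (auto simp: last_rev hd_map plus_sites_def all_minus_def)
  moreover have "snd ` torus N = {1..int N}" using N by (auto simp: torus_def image_iff)
  moreover have "energy N n D C (?m \<zeta>) \<le> barrier n" if "\<zeta> \<in> set \<omega>" for \<zeta>
    using low[OF that] energy_compl[OF plus_sites_subset D_sub C_sub, where n = n] card_C cD by simp
  ultimately have "\<exists>X\<in>set (rev (map ?m \<omega>)). X \<in> protub_rects N (D \<times> {1..int N}) n a 1"
    using w(2) by (intro opp.path_meets_protub[OF D _ _ _ _ _ _ a]) auto
  then obtain \<zeta> where z: "\<zeta> \<in> set \<omega>" "?m \<zeta> \<in> protub_rects N (D \<times> {1..int N}) n a 1" by auto
  have "torus N - ?m \<zeta> = plus_sites N \<zeta>" using plus_sites_subset by blast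
  then have "\<zeta> = conf_of N (torus N - ?m \<zeta>)"
    using conf_of_plus_sites w(3) z(1) by (auto simp: plus_sites_def)
  then show ?thesis using z unfolding Sigma_minus_def by blast
qed

text \<open>Two routes meet at the set of sites outside B: it is A widened by both neutral strips,
  and also the complement of the full strip reached by filling B under exchanged fields.\<close>

lemma empty_to_torus:
  assumes f: "f = offset N s" and C: "C = f ` {k..<k + n}" and D: "D = f ` {n + 2 * k..<N}"
    and N: "N = 2 * n + 2 * k"
  shows "(low_step N n C D)\<^sup>*\<^sup>* {} (torus N)"
proof -
  have N0: "0 < N" using N n_ge by simp
  have "n + 2 * k + n = N" using N by simp
  then have Ca: "C = arc N (s + int k) n" and Da: "D = arc N (s + int (n + 2 * k)) n"
    using arc_shift[of n N s k] arc_shift[of n N s "n + 2 * k"] N by (simp_all add: C D f)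
  have cD: "card D = n" unfolding Da using N by (intro card_arc) simp
  interpret opp: opposing_strips N n D C
    using N_ge n_ge C_sub D_sub CD card_C cD by unfold_locales auto
  have all: "f ` {..<N} = {1..int N}"
    using card_subset_eq[of "{1..int N}" "f ` {..<N}"] offset_in[OF N0] card_image[OF offset_inj, of N s]
    unfolding f by (simp add: image_subsetI)
  have split: "torus N - D \<times> {1..int N} = f ` {..<n + 2 * k} \<times> {1..int N}"
  proof -
    have "{1..int N} - D = f ` ({..<N} - {n + 2 * k..<N})"
      unfolding all[symmetric] D f by (rule inj_on_image_set_diff[OF offset_inj, symmetric]) auto
    also have "{..<N} - {n + 2 * k..<N} = {..<n + 2 * k}" using N by auto
    finally show ?thesis by (auto simp: torus_def)
  qed
  have compl: "E (torus N - W) = energy N n D C W" if "W \<subseteq> torus N" for W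
    using energy_compl[OF that C_sub D_sub] card_C cD by simp
  have "(low_step N n C D)\<^sup>*\<^sup>* (torus N - X) (torus N - Y)" if "(low_step N n D C)\<^sup>*\<^sup>* X Y" for X Y
    using that
  proof (induction rule: rtranclp_induct)
    case (step Y Z)
    have "low_step N n C D (torus N - Y) (torus N - Z)"
      using step.hyps(2) flip_step_compl[of Y "torus N" Z] compl by (simp add: low_step_def)
    then show ?case using step.IH by simp
  qed simp
  \<comment> \<open>Complementing the route that fills B leads from the full torus down to the
    complement of B; reversibility of \<open>low_step\<close> gives the direction wanted.\<close>
  from this[OF opp.empty_to_strip(1)[OF Da]]
  have "(low_step N n C D)\<^sup>*\<^sup>* (f ` {..<n + 2 * k} \<times> {1..int N}) (torus N)"
    unfolding split Diff_empty by (rule low_step_rtranclp_sym)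
  moreover have "(low_step N n C D)\<^sup>*\<^sup>* (C \<times> {1..int N}) (f ` {..<n + 2 * k} \<times> {1..int N})"
    using strip_to_neutral[OF f C D] empty_to_strip(2)[OF Ca] N by simp
  ultimately show ?thesis using empty_to_strip(1)[OF Ca] by simp
qed

end

theorem lemma4p9:
  fixes N n m k :: nat and s :: int and \<alpha> :: real
    and A B :: "site set" and H :: "conf \<Rightarrow> real"
  assumes "N = n + m + 2 * k" and "even N"
    and "3 \<le> n" and "n \<le> m"
    and "1 \<le> k" and "real k < real N / 2"
    and "\<alpha> = real n"
    and "A = strip_A s n m k" and "B = strip_B s n m k"
    and "H = hamiltonian N A B \<alpha>"
  shows
    "(m = n \<longrightarrow>
        (\<forall>\<omega> \<in> opt_paths N H (all_minus N) {all_plus N}. \<forall>a \<in> {n - 1..N - 2}.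
           set \<omega> \<inter> Sigma_plus N (protub_rects N A n a 1) \<noteq> {} \<and>
           set \<omega> \<inter> Sigma_minus N (protub_rects N B n a 1) \<noteq> {})) \<and>
     (m > n \<longrightarrow>
        (\<forall>\<omega> \<in> opt_paths N H (all_minus N) (strip_confs s n m k). \<forall>a \<in> {n - 1..N - 2}.
           set \<omega> \<inter> Sigma_plus N (protub_rects N A n a 1) \<noteq> {}))"
proof -
  \<comment> \<open>s - k is the first column of the neutral strip preceding A, the origin used in
    \<open>strip_to_neutral\<close>.\<close>
  define f where "f = offset N (s - int k)"
  define C where "C = arc N s n"
  define D where "D = arc N (s + int n + int k) m"
  note N = assms(1)
  have N0: "0 < N" using N assms(3) by simp
  have A: "A = C \<times> {1..int N}" and B: "B = D \<times> {1..int N}"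
    using assms by (simp_all add: strip_A_def strip_B_def strip_def C_def D_def)
  have Cf: "C = f ` {k..<k + n}" using arc_shift[of n N "s - int k" k] N by (simp add: C_def f_def)
  have Df: "D = f ` {n + 2 * k..<N}"
    using arc_shift[of m N "s - int k" "n + 2 * k"] N by (simp add: D_def f_def algebra_simps)
  have disj: "C \<inter> D = {}"
    unfolding Cf Df f_def using N
    by (subst inj_on_image_Int[OF offset_inj, symmetric]) auto
  interpret opposing_strips N n C D
  proof
    show "C \<subseteq> {1..int N}" "D \<subseteq> {1..int N}" by (simp_all add: C_def D_def arc_subset)
    show "card C = n" "n \<le> card D" using N assms by (simp_all add: C_def D_def card_arc)
  qed (use assms disj in auto)
  have H: "H = hamiltonian N (C \<times> {1..int N}) (D \<times> {1..int N}) (real n)"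
    using assms A B by simp
  have snd_full: "snd ` (C \<times> {1..int N}) = {1..int N}" using card_C n_ge by (auto simp: image_iff)
  show ?thesis
  proof (intro conjI impI ballI)
    fix \<omega> a assume mn: "m = n" and opt: "\<omega> \<in> opt_paths N H (all_minus N) {all_plus N}" and a: "a \<in> {n - 1..N - 2}"
    have path: "\<omega> \<in> paths N (all_minus N) {all_plus N}" using opt by (simp add: opt_paths_def)
    have low: "E (plus_sites N \<zeta>) \<le> barrier n" if "\<zeta> \<in> set \<omega>" for \<zeta>
      using opt_path_energy_le[OF H opt empty_to_torus[OF f_def Cf Df] _ that] N mn
      by (simp add: all_plus_conf_of)
    have "plus_sites N (last \<omega>) = torus N"
      using path by (auto simp: paths_def plus_sites_def all_plus_def)
    then have "snd ` plus_sites N (last \<omega>) = {1..int N}" using N0 by (auto simp: torus_def image_iff)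
    then show "set \<omega> \<inter> Sigma_plus N (protub_rects N A n a 1) \<noteq> {}"
      unfolding A using path_meets_Sigma_plus[OF C_def path _ low] a by simp
    show "set \<omega> \<inter> Sigma_minus N (protub_rects N B n a 1) \<noteq> {}"
      unfolding B using path_meets_Sigma_minus[OF D_def[unfolded mn] path low] a by simp
  next
    fix \<omega> a assume opt: "\<omega> \<in> opt_paths N H (all_minus N) (strip_confs s n m k)" and a: "a \<in> {n - 1..N - 2}"
    have path: "\<omega> \<in> paths N (all_minus N) (strip_confs s n m k)" using opt by (simp add: opt_paths_def)
    \<comment> \<open>A itself is the widened strip with no added columns, so filling A is already a
      competing path to the target.\<close>
    have "widened_A s n m k 0 0 = A" using assms(8) by (simp add: widened_A_def strip_def arc_zero)
    moreover have "conf_of N (widened_A s n m k 0 0) \<in> strip_confs s n m k"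
      unfolding strip_confs_def N by (blast intro: le0)
    ultimately have "conf_of N (C \<times> {1..int N}) \<in> strip_confs s n m k" using A by simp
    from opt_path_energy_le[OF H opt empty_to_strip(1)[OF C_def] this]
    have low: "E (plus_sites N \<zeta>) \<le> barrier n" if "\<zeta> \<in> set \<omega>" for \<zeta> using that by blast
    obtain l p where lp: "last \<omega> = conf_of N (widened_A s n m k l p)"
      using path N by (auto simp: paths_def strip_confs_def)
    \<comment> \<open>Every element of the target contains the full strip A and thus a plus site in
      each row.\<close>
    have "C \<times> {1..int N} \<subseteq> plus_sites N (last \<omega>)"
      unfolding lp using A assms(8) C_sub by (auto simp: widened_A_def plus_sites_def conf_of_def torus_def)
    then have "snd ` plus_sites N (last \<omega>) = {1..int N}"
      using snd_full snd_torus[OF plus_sites_subset, of N "last \<omega>"] by blast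
    then show "set \<omega> \<inter> Sigma_plus N (protub_rects N A n a 1) \<noteq> {}"
      unfolding A using path_meets_Sigma_plus[OF C_def path _ low] a by simp
  qed
qed

end
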